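(* For each integer $r \geq 2$, let $d_{r,r}$ be the smallest nonnegative integer such that whenever $X$ and $Y$ are edge-subgraphs of $K_{r,r}$ with $\delta(X) \geq d_{r,r}$ and $\delta(Y) \geq d_{r,r}$, the friends-and-strangers graph $\mathsf{FS}(X,Y)$ has exactly two connected components. Then $$d_{r,r} = \lceil (3r+1)/4 \rceil.$$
   Context: All graphs are simple. $K_{r,r}$ is the complete bipartite graph whose two partite sets both have size $r$. An edge-subgraph of a graph $G$ is a graph with the same vertex set as $G$ whose edge set is a subset of $E(G)$. $\delta(G)$ denotes the minimum degree of $G$. For simple graphs $X$ and $Y$ on $n$ vertices each, the friends-and-strangers graph $\mathsf{FS}(X,Y)$ is the graph whose vertices are all bijections $V(X) \to V(Y)$, in which two bijections $\sigma, \tau$ are adjacent if and only if there is an edge $\{a,b\} \in E(X)$ such that $\{\sigma(a),\sigma(b)\} \in E(Y)$, $\sigma(a)=\tau(b)$, $\sigma(b)=\tau(a)$, and $\sigma(c)=\tau(c)$ for all $c \in V(X)\setminus\{a,b\}$. *)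

theory Defs
  imports Complex_Main "HOL-Library.FuncSet" "Graph_Theory.Graph_Theory"
begin

text \<open>
  A finite simple graph is a \<^locale>\<open>pair_graph\<close>: an irreflexive, symmetric arc relation on a
  finite vertex set, an undirected edge being a pair of opposite arcs.  Hence the degree of
  a vertex is its out-degree, and the connected components are the strongly connected ones.
\<close>

definition min_degree :: "'a pair_pre_digraph \<Rightarrow> nat" where
  "min_degree G = Min (out_degree (with_proj G) ` pverts G)"

text \<open>
  \<^const>\<open>spanning\<close> alone would allow one arc of an edge to be deleted without the other.
\<close>

definition edge_subgraph :: "'a pair_pre_digraph \<Rightarrow> 'a pair_pre_digraph \<Rightarrow> bool" where
  "edge_subgraph H G \<longleftrightarrow> pair_graph H \<and> spanning (with_proj H) (with_proj G)"

text \<open>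
  A bijection is represented by a function that is \<^const>\<open>undefined\<close> outside the vertex
  set of \<open>X\<close>, so that distinct vertices of the graph are distinct bijections.
\<close>

definition graph_bijections :: "'a pair_pre_digraph \<Rightarrow> 'b pair_pre_digraph \<Rightarrow> ('a \<Rightarrow> 'b) set" where
  "graph_bijections X Y =
    {\<sigma> \<in> extensional (pverts X). bij_betw \<sigma> (pverts X) (pverts Y)}"

definition friends_strangers ::
  "'a pair_pre_digraph \<Rightarrow> 'b pair_pre_digraph \<Rightarrow> ('a \<Rightarrow> 'b) pair_pre_digraph" where
  "friends_strangers X Y =
    \<lparr> pverts = graph_bijections X Y,
      parcs = {(\<sigma>, \<tau>). \<sigma> \<in> graph_bijections X Y \<and> \<tau> \<in> graph_bijections X Y \<and>
        (\<exists>a b. (a, b) \<in> parcs X \<and> (\<sigma> a, \<sigma> b) \<in> parcs Y \<and>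
          \<sigma> a = \<tau> b \<and> \<sigma> b = \<tau> a \<and> (\<forall>c \<in> pverts X - {a, b}. \<sigma> c = \<tau> c))} \<rparr>"

lemma pair_graph_friends_strangers:
  assumes "pair_graph X" "pair_graph Y"
  shows "pair_graph (friends_strangers X Y)"
proof -
  interpret X: pair_graph X by fact
  interpret Y: pair_graph Y by fact
  let ?F = "friends_strangers X Y"
  have "graph_bijections X Y \<subseteq> (\<Pi>\<^sub>E v\<in>pverts X. pverts Y)"
    by (auto simp: graph_bijections_def bij_betw_def PiE_def)
  then have fin: "finite (pverts ?F)"
    using finite_subset finite_PiE[OF X.pair_finite_verts, of "\<lambda>_. pverts Y"]
      Y.pair_finite_verts by (fastforce simp: friends_strangers_def)
  have sub: "parcs ?F \<subseteq> pverts ?F \<times> pverts ?F"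
    by (auto simp: friends_strangers_def)
  have symY: "(b, a) \<in> parcs Y" if "(a, b) \<in> parcs Y" for a b
    using Y.pair_sym_arcs that by (auto simp: symmetric_def dest: symD)
  have "sym (parcs ?F)"
  proof (rule symI)
    fix \<sigma> \<tau> assume "(\<sigma>, \<tau>) \<in> parcs ?F"
    then obtain a b where "\<sigma> \<in> graph_bijections X Y" "\<tau> \<in> graph_bijections X Y"
      "(a, b) \<in> parcs X" "(\<sigma> a, \<sigma> b) \<in> parcs Y" "\<sigma> a = \<tau> b" "\<sigma> b = \<tau> a"
      "\<forall>c \<in> pverts X - {a, b}. \<sigma> c = \<tau> c"
      by (auto simp: friends_strangers_def)
    moreover from this have "(\<tau> a, \<tau> b) \<in> parcs Y"
      using symY by metis
    ultimately have "(a, b) \<in> parcs X \<and> (\<tau> a, \<tau> b) \<in> parcs Y \<and>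
      \<tau> a = \<sigma> b \<and> \<tau> b = \<sigma> a \<and> (\<forall>c \<in> pverts X - {a, b}. \<tau> c = \<sigma> c)"
      by simp
    then show "(\<tau>, \<sigma>) \<in> parcs ?F"
      using \<open>\<sigma> \<in> graph_bijections X Y\<close> \<open>\<tau> \<in> graph_bijections X Y\<close>
      unfolding friends_strangers_def by auto
  qed
  moreover have "fst e \<noteq> snd e" if e: "e \<in> parcs ?F" for e
  proof
    assume "fst e = snd e"
    with e obtain \<sigma> a b where "(\<sigma> a, \<sigma> b) \<in> parcs Y" "\<sigma> a = \<sigma> b"
      by (auto simp: friends_strangers_def)
    then show False
      using Y.pair_no_loops by fastforce
  qed
  moreover have "finite (parcs ?F)"
    using finite_subset[OF sub finite_cartesian_product[OF fin fin]] .
  ultimately show ?thesis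
    using fin sub by unfold_locales (auto simp: symmetric_def)
qed

definition num_components :: "'a pair_pre_digraph \<Rightarrow> nat" where
  "num_components G = card (pre_digraph.sccs (with_proj G))"

text \<open>
  \<open>K\<close> ranges over all copies of the complete bipartite graph on vertices of type \<^typ>\<open>nat\<close>; the
  property depends on graphs only up to isomorphism.  For
  \<open>r \<ge> 1\<close> the minimum exists, since every \<open>d > r\<close> satisfies the condition vacuously.
\<close>

definition d_bipartite :: "nat \<Rightarrow> nat" where
  "d_bipartite r = (LEAST d. \<forall>K X Y :: nat pair_pre_digraph.
     complete_bipartite_digraph r r (with_proj K) \<longrightarrow>
     edge_subgraph X K \<longrightarrow> edge_subgraph Y K \<longrightarrow>
     min_degree X \<ge> d \<longrightarrow> min_degree Y \<ge> d \<longrightarrow>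
     num_components (friends_strangers X Y) = 2)"

end

theory Submission
  imports Defs "HOL-Combinatorics.Permutations"
begin

text \<open>
  Upper bound.  Let \<open>m = r - d\<close> be the number of neighbours a vertex may miss, so \<open>4 m + 1 \<le> r\<close>.  The heart
  is an exchange property: if adjacent positions \<open>a\<close>, \<open>b\<close> carry people from opposite sides of \<open>Y\<close>, then
  these two people can be interchanged even when they are not adjacent in \<open>Y\<close>.  Leaving \<open>a\<close> and \<open>b\<close>
  untouched, move the other people so that as few as possible stand on the wrong side.  A
  count of missing neighbours shows that then either everybody is on the right side, or the count is
  tight everywhere; in both cases some five or six positions carry a configuration in which an
  explicit sequence of swaps performs the exchange, and the preparatory moves can be undone.
  Hence \<open>Y\<close>, and by passing to inverse bijections also \<open>X\<close>, may be replaced by the complete bipartite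
  graph.  There two components remain, distinguished by the sign of the permutation
  times a sign counting the people on the right side.

  Lower bound.  For smaller \<open>d\<close> there is a pair of graphs with an isolated bijection, and
  the invariant gives two further components.
\<close>

section \<open>Swap sequences\<close>

text \<open>An arrangement \<open>\<sigma>\<close> tells which person stands at each position.
  Arrangements are total functions here, so that a swap is composition with a transposition and the
  algebra of permutations applies.\<close>

inductive fs_reach ::
    "('a \<Rightarrow> 'a \<Rightarrow> bool) \<Rightarrow> ('b \<Rightarrow> 'b \<Rightarrow> bool) \<Rightarrow> ('a \<Rightarrow> 'b) \<Rightarrow> ('a \<Rightarrow> 'b) \<Rightarrow> bool"
  for E F where
  refl: "fs_reach E F \<sigma> \<sigma>"
| step: "fs_reach E F \<sigma> \<tau> \<Longrightarrow> E a b \<Longrightarrow> F (\<tau> a) (\<tau> b) \<Longrightarrow> fs_reach E F \<sigma> (\<tau> \<circ> transpose a b)"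

lemma fs_reach_swap:
  assumes "E a b" "F (\<sigma> a) (\<sigma> b)"
  shows "fs_reach E F \<sigma> (\<sigma> \<circ> transpose a b)"
  using fs_reach.step[where E=E and F=F, OF fs_reach.refl] assms by blast

lemma fs_reach_trans [trans]:
  assumes "fs_reach E F \<sigma> \<tau>" "fs_reach E F \<tau> \<upsilon>"
  shows "fs_reach E F \<sigma> \<upsilon>"
  using assms(2,1) by (induction rule: fs_reach.induct) (auto intro: fs_reach.step)

lemma fs_reach_sym:
  assumes "fs_reach E F \<sigma> \<tau>" "symp F"
  shows "fs_reach E F \<tau> \<sigma>"
  using assms(1)
proof (induction rule: fs_reach.induct)
  case (step \<sigma> \<tau> a b)
  have "F ((\<tau> \<circ> transpose a b) a) ((\<tau> \<circ> transpose a b) b)"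
    using step(3) assms(2) by (simp add: sympD)
  from fs_reach_swap[of E a b F "\<tau> \<circ> transpose a b", OF step(2) this]
  have "fs_reach E F (\<tau> \<circ> transpose a b) \<tau>"
    by (simp add: o_assoc[symmetric])
  then show ?case using step.IH by (rule fs_reach_trans)
qed (rule fs_reach.refl)

text \<open>The list is chronological: later swaps are composed further to the right and therefore
  act on a position first.\<close>

fun swaps :: "('a \<times> 'a) list \<Rightarrow> 'a \<Rightarrow> 'a" where
  "swaps [] x = x"
| "swaps ((a, b) # l) x = transpose a b (swaps l x)"

fun legal_swaps :: "('a \<Rightarrow> 'a \<Rightarrow> bool) \<Rightarrow> ('b \<Rightarrow> 'b \<Rightarrow> bool) \<Rightarrow> ('a \<times> 'a) list \<Rightarrow> ('a \<Rightarrow> 'b) \<Rightarrow> bool" where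
  "legal_swaps E F [] \<sigma> \<longleftrightarrow> True"
| "legal_swaps E F ((a, b) # l) \<sigma> \<longleftrightarrow>
    E a b \<and> F (\<sigma> a) (\<sigma> b) \<and> legal_swaps E F l (\<sigma> \<circ> transpose a b)"

lemma fs_reach_swaps:
  "legal_swaps E F l \<sigma> \<Longrightarrow> fs_reach E F \<sigma> (\<sigma> \<circ> swaps l)"
proof (induction l arbitrary: \<sigma>)
  case Nil
  then show ?case using fs_reach.refl[of E F \<sigma>] by (simp add: comp_def)
next
  case (Cons e l)
  obtain a b where e: "e = (a, b)" by force
  have "fs_reach E F \<sigma> (\<sigma> \<circ> transpose a b)"
    using Cons.prems e by (intro fs_reach_swap) simp_all
  also have "fs_reach E F \<dots> (\<sigma> \<circ> transpose a b \<circ> swaps l)"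
    using Cons.prems e by (intro Cons.IH) (simp only: legal_swaps.simps)
  also have "\<sigma> \<circ> transpose a b \<circ> swaps l = \<sigma> \<circ> swaps (e # l)"
    by (simp add: e fun_eq_iff)
  finally show ?case .
qed

lemma swaps_other:
  "x \<notin> fst ` set l \<Longrightarrow> x \<notin> snd ` set l \<Longrightarrow> swaps l x = x"
  by (induction l) auto

text \<open>Reduces a concrete sequence to a finite evaluation: both maps fix every position outside
  \<open>ps\<close>, so they need to be compared only on \<open>ps\<close>.\<close>

lemma fs_reach_swapsI:
  assumes "legal_swaps E F l \<sigma>"
    and "map (swaps l) ps = map (transpose a b) ps"
    and "fst ` set l \<union> snd ` set l \<subseteq> set ps" "a \<in> set ps" "b \<in> set ps"
  shows "fs_reach E F \<sigma> (\<sigma> \<circ> transpose a b)"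
proof -
  have "swaps l = transpose a b"
  proof
    fix x
    show "swaps l x = transpose a b x"
    proof (cases "x \<in> set ps")
      case False
      then have "x \<notin> fst ` set l" "x \<notin> snd ` set l" "x \<noteq> a" "x \<noteq> b"
        using assms(3-5) by auto
      then show ?thesis by (simp add: swaps_other)
    qed (use assms(2) in simp)
  qed
  with fs_reach_swaps[OF assms(1)] show ?thesis by simp
qed

text \<open>
  The swap sequences below were found by breadth-first search.  In them, an assumption
  \<^prop>\<open>F (\<sigma> p) (\<sigma> q)\<close> says that the people standing at \<open>p\<close> and \<open>q\<close> are friends.
\<close>

lemma swap_gadget_23:
  assumes F: "symp F" and d: "distinct [a, p, b, q, r]"
    and E: "E a b" "E a q" "E a r" "E p b" "E p q" "E p r"
    and G: "F (\<sigma> a) (\<sigma> q)" "F (\<sigma> a) (\<sigma> r)" "F (\<sigma> p) (\<sigma> b)" "F (\<sigma> p) (\<sigma> q)" "F (\<sigma> p) (\<sigma> r)"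
  shows "fs_reach E F \<sigma> (\<sigma> \<circ> transpose a b)"
proof (rule fs_reach_swapsI)
  \<comment> \<open>The reversed list gives the simplifier every inequality in the other orientation
    too.\<close>
  have d': "distinct [r, q, b, p, a]"
    using d by auto
  let ?l = "[(a,q), (p,r), (a,r), (a,b), (p,b), (p,r), (p,q), (p,b), (p,r)]"
  show "legal_swaps E F ?l \<sigma>"
    using d d' E G G[THEN sympD[OF F]] by simp
  show "map (swaps ?l) [a, p, b, q, r] = map (transpose a b) [a, p, b, q, r]"
    using d d' by simp
qed auto

text \<open>This gadget and the next settle the tight case in which everybody is on the right side.
  They differ in the last pair: here the people at \<open>r\<close> and \<open>s\<close> are
  friends, there the positions \<open>r\<close> and \<open>s\<close> are adjacent.\<close>

lemma swap_gadget_33_A: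
  assumes F: "symp F" and d: "distinct [a, p, r, b, q, s]"
    and E: "E a b" "E a q" "E a s" "E p b" "E p s" "E r b" "E r q"
    and G: "F (\<sigma> a) (\<sigma> q)" "F (\<sigma> p) (\<sigma> b)" "F (\<sigma> p) (\<sigma> q)" "F (\<sigma> p) (\<sigma> s)"
      "F (\<sigma> r) (\<sigma> q)" "F (\<sigma> r) (\<sigma> s)"
  shows "fs_reach E F \<sigma> (\<sigma> \<circ> transpose a b)"
proof (rule fs_reach_swapsI)
  have d': "distinct [s, q, b, r, p, a]"
    using d by auto
  let ?l = "[(a,q), (p,b), (a,b), (a,s), (p,s), (r,b), (a,b), (p,b), (r,q), (a,q), (a,b), (a,s), (p,s),
    (r,b), (r,q)]"
  show "legal_swaps E F ?l \<sigma>"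
    using d d' E G G[THEN sympD[OF F]] by simp
  show "map (swaps ?l) [a, p, r, b, q, s] = map (transpose a b) [a, p, r, b, q, s]"
    using d d' by simp
qed auto

lemma swap_gadget_33_B:
  assumes F: "symp F" and d: "distinct [a, p, r, b, q, s]"
    and E: "E a b" "E a s" "E p b" "E p s" "E r b" "E r q" "E r s"
    and G: "F (\<sigma> a) (\<sigma> q)" "F (\<sigma> a) (\<sigma> s)" "F (\<sigma> p) (\<sigma> b)" "F (\<sigma> p) (\<sigma> q)" "F (\<sigma> p) (\<sigma> s)"
      "F (\<sigma> r) (\<sigma> q)"
  shows "fs_reach E F \<sigma> (\<sigma> \<circ> transpose a b)"
proof (rule fs_reach_swapsI)
  have d': "distinct [s, q, b, r, p, a]"
    using d by auto
  let ?l = "[(a,s), (r,q), (r,s), (p,s), (a,s), (a,b), (p,b), (r,b), (r,q)]"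
  show "legal_swaps E F ?l \<sigma>"
    using d d' E G G[THEN sympD[OF F]] by simp
  show "map (swaps ?l) [a, p, r, b, q, s] = map (transpose a b) [a, p, r, b, q, s]"
    using d d' by simp
qed auto

text \<open>In this gadget and the next, \<open>x\<close> and \<open>y\<close> carry people of the
  wrong side: the positions split into \<open>a, p, x\<close> and \<open>b, q, y\<close>, but the
  people standing there into those at \<open>a, p, y\<close> and those at
  \<open>b, q, x\<close>.\<close>

lemma swap_gadget_33_C:
  assumes F: "symp F" and d: "distinct [a, p, x, b, q, y]"
    and E: "E a b" "E a q" "E a y" "E p b" "E p y" "E x b" "E x q" "E x y"
    and G: "F (\<sigma> a) (\<sigma> x)" "F (\<sigma> a) (\<sigma> q)" "F (\<sigma> p) (\<sigma> b)" "F (\<sigma> p) (\<sigma> x)" "F (\<sigma> p) (\<sigma> q)"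
      "F (\<sigma> y) (\<sigma> q)"
  shows "fs_reach E F \<sigma> (\<sigma> \<circ> transpose a b)"
proof (rule fs_reach_swapsI)
  have d': "distinct [y, q, b, x, p, a]"
    using d by auto
  let ?l = "[(a,q), (p,b), (a,b), (x,q), (x,b), (x,y), (a,y), (a,b), (a,q), (p,y), (p,b), (a,b), (a,y),
    (p,y), (x,y), (x,q), (x,b)]"
  show "legal_swaps E F ?l \<sigma>"
    using d d' E G G[THEN sympD[OF F]] by simp
  show "map (swaps ?l) [a, p, x, b, q, y] = map (transpose a b) [a, p, x, b, q, y]"
    using d d' by simp
qed auto

lemma swap_gadget_33_D:
  assumes F: "symp F" and d: "distinct [a, p, x, b, q, y]"
    and E: "E a b" "E a q" "E a y" "E p b" "E p y" "E x b" "E x q"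
    and G: "F (\<sigma> a) (\<sigma> x)" "F (\<sigma> a) (\<sigma> q)" "F (\<sigma> p) (\<sigma> b)" "F (\<sigma> p) (\<sigma> x)" "F (\<sigma> p) (\<sigma> q)"
      "F (\<sigma> y) (\<sigma> b)" "F (\<sigma> y) (\<sigma> x)" "F (\<sigma> y) (\<sigma> q)"
  shows "fs_reach E F \<sigma> (\<sigma> \<circ> transpose a b)"
proof (rule fs_reach_swapsI)
  have d': "distinct [y, q, b, x, p, a]"
    using d by auto
  let ?l = "[(a,q), (a,y), (p,b), (x,q), (a,q), (a,b), (a,y), (a,q), (p,y), (a,y), (x,b)]"
  show "legal_swaps E F ?l \<sigma>"
    using d d' E G G[THEN sympD[OF F]] by simp
  show "map (swaps ?l) [a, p, x, b, q, y] = map (transpose a b) [a, p, x, b, q, y]"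
    using d d' by simp
qed auto

section \<open>Counting missing neighbours\<close>

text \<open>Apart from symmetry, only pairs across the two sides are constrained, since a relation
  pulled back along a bijection is controlled only between the two preimages.\<close>

definition nearly_complete :: "'a set \<Rightarrow> 'a set \<Rightarrow> nat \<Rightarrow> ('a \<Rightarrow> 'a \<Rightarrow> bool) \<Rightarrow> bool" where
  "nearly_complete A B m E \<longleftrightarrow> finite A \<and> finite B \<and> A \<inter> B = {} \<and> symp E \<and>
    (\<forall>x\<in>A. card {y \<in> B. \<not> E x y} \<le> m) \<and> (\<forall>y\<in>B. card {x \<in> A. \<not> E y x} \<le> m)"

lemma nearly_complete_commute: "nearly_complete A B m E \<longleftrightarrow> nearly_complete B A m E"
  unfolding nearly_complete_def by blast

lemma card_le_of_cover:
  assumes "S \<subseteq> T \<union> U" "finite T" "finite U" "card T \<le> m" "card U \<le> m"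
  shows "card S \<le> 2 * m"
  using card_mono[OF _ assms(1)] card_Un_le[of T U] assms by simp

text \<open>The equality case of the preceding bound: two sets of size at most \<open>m\<close> that
  cover \<open>2 * m\<close> elements have no room for overlap or for further elements. This turns
  numerical tightness into adjacencies.\<close>

lemma tight_cover:
  assumes "S \<subseteq> T \<union> U" "finite T" "finite U" "card T \<le> m" "card U \<le> m" "card S = 2 * m"
  shows "T \<union> U = S" "T \<inter> U = {}"
proof -
  have le: "card (T \<union> U) + card (T \<inter> U) \<le> 2 * m"
    using card_Un_Int[OF assms(2,3)] assms(4,5) by simp
  have "card S \<le> card (T \<union> U)"
    using assms(1-3) by (intro card_mono) auto
  with le assms(6) have "card (T \<inter> U) = 0" "card (T \<union> U) = card S"
    by linarith+
  then show "T \<union> U = S" "T \<inter> U = {}"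
    using assms(1-3) card_subset_eq[of "T \<union> U" S] by auto
qed

text \<open>
  Positions and people are identified here: \<open>C\<close> and \<open>D\<close> are the positions occupied by the two sides of \<open>Y\<close>,
  and \<open>G\<close> relates positions occupied by friends.  The assumptions \<open>block\<close> and \<open>hop\<close> exclude the
  one-step and three-step moves that would shrink \<^term>\<open>A \<inter> D\<close>.  They force every estimate
  in \<open>sum\<close> to be an equality.
\<close>

lemma not_all_aligned_alternatives:
  assumes E: "nearly_complete A B m E" and G: "nearly_complete C D m G"
    and V: "A \<union> B = C \<union> D"
    and r: "card A = r" "card B = r" "card C = r" "card D = r" "4 * m + 1 \<le> r"
    and a: "a \<in> A" "a \<in> C" and b: "b \<in> B" "b \<in> D"
    and x: "x \<in> A" "x \<in> D" and y: "y \<in> B" "y \<in> C"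
    and block: "\<And>x y. x \<in> A \<inter> D \<Longrightarrow> y \<in> B \<inter> C \<Longrightarrow> E x y \<Longrightarrow> G x y \<Longrightarrow> False"
    and hop: "\<And>p q. p \<in> A \<inter> C - {a} \<Longrightarrow> q \<in> B \<inter> D - {b} \<Longrightarrow>
      E p q \<Longrightarrow> G p q \<Longrightarrow> E x q \<Longrightarrow> G p x \<Longrightarrow> E p y \<Longrightarrow> G q y \<Longrightarrow> False"
  obtains p q where "p \<in> A \<inter> C - {a}" "q \<in> B \<inter> D - {b}"
    "E a q" "E a y" "E p b" "E p y" "E x b" "E x q"
    "G a x" "G a q" "G p b" "G p x" "G p q" "G y b" "G y q"
    "E x y \<or> G x y"
proof -
  have fin: "finite A" "finite B" "finite C" "finite D"
    and disj: "A \<inter> B = {}" "C \<inter> D = {}"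
    and symE: "\<And>u v. E u v \<Longrightarrow> E v u" and symG: "\<And>u v. G u v \<Longrightarrow> G v u"
    and missE: "\<And>u. u \<in> A \<Longrightarrow> card {v \<in> B. \<not> E u v} \<le> m" "\<And>u. u \<in> B \<Longrightarrow> card {v \<in> A. \<not> E u v} \<le> m"
    and missG: "\<And>u. u \<in> C \<Longrightarrow> card {v \<in> D. \<not> G u v} \<le> m" "\<And>u. u \<in> D \<Longrightarrow> card {v \<in> C. \<not> G u v} \<le> m"
    using E G unfolding nearly_complete_def by (auto dest: sympD)
  \<comment> \<open>\<open>P\<close> and \<open>Z\<close> collect the conditions of
    \<open>hop\<close> on \<open>p\<close> alone and on \<open>q\<close> alone. Hence no pair from
    \<open>P\<close> and \<open>Z\<close> can be related by both \<open>E\<close> and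
    \<open>G\<close>.\<close>
  define P where "P = {p \<in> A \<inter> C - {a}. G p x \<and> E p y}"
  define Z where "Z = {q \<in> B \<inter> D - {b}. E x q \<and> G q y}"
  define Ex where "Ex = {v \<in> B. \<not> E x v}"
  define Gx where "Gx = {v \<in> C. \<not> G x v}"
  define Ey where "Ey = {v \<in> A. \<not> E y v}"
  define Gy where "Gy = {v \<in> D. \<not> G y v}"
  note defs = P_def Z_def Ex_def Gx_def Ey_def Gy_def
  have le: "card Ex \<le> m" "card Gx \<le> m" "card Ey \<le> m" "card Gy \<le> m"
    unfolding defs using missE missG x y by auto
  have finN: "finite Ex" "finite Gx" "finite Ey" "finite Gy" "finite P" "finite Z"
    unfolding defs using fin by auto
  \<comment> \<open>\<open>l\<close> counts the misplaced positions of a side, \<open>k\<close> the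
    aligned ones other than \<open>a\<close> or \<open>b\<close>. As all four sets have size
    \<open>r\<close>, both counts agree on the two sides.\<close>
  define k where "k = card (A \<inter> C - {a})"
  define l where "l = card (A \<inter> D)"
  have split: "card (S \<inter> U) + card (S \<inter> W) = card S"
    if "finite S" "S \<subseteq> U \<union> W" "U \<inter> W = {}" for S U W :: "'a set"
  proof -
    have "card (S \<inter> U) + card (S \<inter> W) = card (S \<inter> U \<union> S \<inter> W)"
      using that by (intro card_Un_disjoint[symmetric]) auto
    also have "S \<inter> U \<union> S \<inter> W = S" using that by blast
    finally show ?thesis .
  qed
  have splitA: "card (A \<inter> C) + card (A \<inter> D) = r"
    using split[of A C D] fin disj V r(1) by blast
  have splitB: "card (B \<inter> C) + card (B \<inter> D) = r"
    using split[of B C D] fin disj V r(2) by blast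
  have splitC: "card (A \<inter> C) + card (B \<inter> C) = r"
    using split[of C A B] fin disj V r(3) by (metis Int_commute sup_ge1)
  have kl: "k + l + 1 = r"
    using splitA a fin card_Suc_Diff1[of "A \<inter> C" a] unfolding k_def l_def by auto
  have BC: "card (B \<inter> C) = l" and BD: "card (B \<inter> D - {b}) = k"
    using splitA splitB splitC kl b fin card_Suc_Diff1[of "B \<inter> D" b] unfolding l_def by auto
  have l_pos: "l \<ge> 1"
    using x fin unfolding l_def by (auto simp: Suc_le_eq card_gt_0_iff)
  have le_kP: "k \<le> card P + card (Gx \<inter> (A - {a})) + card (Ey \<inter> (C - {a}))"
  proof -
    have "A \<inter> C - {a} \<subseteq> P \<union> (Gx \<inter> (A - {a})) \<union> (Ey \<inter> (C - {a}))"
      unfolding defs using symE symG by blast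
    from card_mono[OF _ this] finN show ?thesis
      using card_Un_le[of "P \<union> (Gx \<inter> (A - {a}))" "Ey \<inter> (C - {a})"] card_Un_le[of P "Gx \<inter> (A - {a})"]
      unfolding k_def by auto
  qed
  have le_kZ: "k \<le> card Z + card (Ex \<inter> (D - {b})) + card (Gy \<inter> (B - {b}))"
  proof -
    have "B \<inter> D - {b} \<subseteq> Z \<union> (Ex \<inter> (D - {b})) \<union> (Gy \<inter> (B - {b}))"
      unfolding defs using symE symG by blast
    from card_mono[OF _ this] finN show ?thesis
      using card_Un_le[of "Z \<union> (Ex \<inter> (D - {b}))" "Gy \<inter> (B - {b})"] card_Un_le[of Z "Ex \<inter> (D - {b})"]
      unfolding BD[symmetric] by auto
  qed
  \<comment> \<open>The overlap \<open>Ex \<inter> Gx\<close> is kept in this estimate because its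
    vanishing yields \<open>E x y \<or> G x y\<close> in the end.\<close>
  have lx: "l + card (Ex \<inter> Gx) \<le> card (Ex \<inter> C) + card (Gx \<inter> B)"
  proof -
    have "B \<inter> C \<subseteq> (Ex \<inter> C) \<union> (Gx \<inter> B)"
      unfolding defs using block[of x] x by blast
    then have "l \<le> card ((Ex \<inter> C) \<union> (Gx \<inter> B))"
      using card_mono[OF _ \<open>B \<inter> C \<subseteq> _\<close>] finN BC by auto
    moreover have "(Ex \<inter> C) \<inter> (Gx \<inter> B) = Ex \<inter> Gx"
      unfolding defs by blast
    ultimately show ?thesis
      using card_Un_Int[of "Ex \<inter> C" "Gx \<inter> B"] finN by simp
  qed
  have ly: "l \<le> card (Ey \<inter> D) + card (Gy \<inter> A)"
  proof -
    have "A \<inter> D \<subseteq> (Ey \<inter> D) \<union> (Gy \<inter> A)"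
      unfolding defs using block[of _ y] y symE symG by blast
    then have "l \<le> card ((Ey \<inter> D) \<union> (Gy \<inter> A))"
      using card_mono[OF _ \<open>A \<inter> D \<subseteq> _\<close>] finN unfolding l_def by auto
    then show ?thesis using card_Un_le[of "Ey \<inter> D" "Gy \<inter> A"] by simp
  qed
  have three: "card (S \<inter> (U - {c})) + card (S \<inter> W) + card (S \<inter> {c}) \<le> card S"
    if "finite S" "U \<inter> W = {}" "c \<in> U" for S U W :: "'a set" and c
  proof -
    have "card (S \<inter> (U - {c})) + card (S \<inter> W) + card (S \<inter> {c})
        = card (S \<inter> (U - {c}) \<union> S \<inter> W \<union> S \<inter> {c})"
      using that by (subst card_Un_disjoint, auto)+
    also have "\<dots> \<le> card S" using that by (intro card_mono) auto
    finally show ?thesis .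
  qed
  have t: "card (Gx \<inter> (A - {a})) + card (Gx \<inter> B) + card (Gx \<inter> {a}) \<le> card Gx"
    "card (Ey \<inter> (C - {a})) + card (Ey \<inter> D) + card (Ey \<inter> {a}) \<le> card Ey"
    "card (Ex \<inter> (D - {b})) + card (Ex \<inter> C) + card (Ex \<inter> {b}) \<le> card Ex"
    "card (Gy \<inter> (B - {b})) + card (Gy \<inter> A) + card (Gy \<inter> {b}) \<le> card Gy"
    by (rule three; use finN disj a b in blast)+
  \<comment> \<open>\<open>\<delta>\<close> gathers the losses that must be shown to vanish: double
    misses of \<open>x\<close>, and \<open>a\<close> or \<open>b\<close> being missed by
    \<open>x\<close> or \<open>y\<close>.\<close>
  define \<delta> where "\<delta> = card (Ex \<inter> Gx) + card (Gx \<inter> {a}) + card (Ey \<inter> {a}) + card (Ex \<inter> {b}) + card (Gy \<inter> {b})"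
  have sum: "2 * (k + l) + \<delta> \<le> card P + card Z + 4 * m"
  proof -
    \<comment> \<open>The cardinalities are abstracted to variables, which leaves a purely linear
      problem: each of the four lists of missing neighbours is charged at most \<open>m\<close> in
      total.\<close>
    have "2 * (k' + l') + (i + gx + ey + ex + gy) \<le> p + z + 4 * m"
      if "k' \<le> p + g1 + e1" "k' \<le> z + e2 + g2" "l' + i \<le> e3 + g3" "l' \<le> e4 + g4"
        "g1 + g3 + gx \<le> G1" "e1 + e4 + ey \<le> E1" "e2 + e3 + ex \<le> E2" "g2 + g4 + gy \<le> G2"
        "E2 \<le> m" "G1 \<le> m" "E1 \<le> m" "G2 \<le> m"
      for k' l' i gx ey ex gy p z g1 g2 g3 g4 e1 e2 e3 e4 E1 E2 G1 G2 :: nat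
    proof -
      have "2 * k' \<le> p + z + (g1 + g2 + e1 + e2)" using that(1,2) by linarith
      moreover have "2 * l' + i \<le> e3 + g3 + e4 + g4" using that(3,4) by linarith
      moreover have "g1 + g2 + e1 + e2 + (e3 + g3 + e4 + g4) + (gx + ey + ex + gy) \<le> 4 * m"
      proof -
        have "g1 + g2 + e1 + e2 + (e3 + g3 + e4 + g4) + (gx + ey + ex + gy)
          = (g1 + g3 + gx) + (e1 + e4 + ey) + (e2 + e3 + ex) + (g2 + g4 + gy)" by simp
        also have "\<dots> \<le> m + m + m + m"
          using that(5-12) by (intro add_mono) linarith+
        finally show ?thesis by simp
      qed
      ultimately show ?thesis by (simp add: algebra_simps)
    qed
    from this[OF le_kP le_kZ lx ly t le] show ?thesis unfolding \<delta>_def .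
  qed
  have PZ: "\<not> (E p q \<and> G p q)" if "p \<in> P" "q \<in> Z" for p q
    using hop[of p q] that unfolding P_def Z_def by blast
  have coverZ: "Z \<subseteq> {v \<in> B. \<not> E p v} \<union> {v \<in> D. \<not> G p v}" if "p \<in> P" for p
    using PZ[OF that] unfolding Z_def by blast
  have coverP: "P \<subseteq> {v \<in> A. \<not> E q v} \<union> {v \<in> C. \<not> G q v}" if "q \<in> Z" for q
    using PZ[OF _ that] symE symG unfolding P_def by blast
  have leZ: "card Z \<le> 2 * m" if "p \<in> P" for p
    using missE(1)[of p] missG(1)[of p] that fin
    by (intro card_le_of_cover[OF coverZ[OF that]]) (auto simp: P_def)
  have leP: "card P \<le> 2 * m" if "q \<in> Z" for q
    using missE(2)[of q] missG(2)[of q] that fin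
    by (intro card_le_of_cover[OF coverP[OF that]]) (auto simp: Z_def)
  have lek: "card P \<le> k" "card Z \<le> k"
  proof -
    show "card P \<le> k" unfolding k_def using fin by (intro card_mono) (auto simp: P_def)
    have "card Z \<le> card (B \<inter> D - {b})" using fin by (intro card_mono) (auto simp: Z_def)
    then show "card Z \<le> k" by (simp only: BD)
  qed
  \<comment> \<open>If one set were empty, the other would have at most \<open>k\<close> elements,
    and \<open>sum\<close> would give \<open>k + 2 * l \<le> 4 * m\<close>, against
    \<open>k + l \<ge> 4 * m\<close> and \<open>l \<ge> 1\<close>.\<close>
  have "P \<noteq> {}" "Z \<noteq> {}"
    using sum lek kl l_pos r(5) by auto
  \<comment> \<open>As \<open>k + l \<ge> 4 * m\<close>, \<open>sum\<close> demands
    \<open>card P + card Z \<ge> 4 * m + \<delta>\<close>, while both sets have at most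
    \<open>2 * m\<close> elements.\<close>
  then have eq: "card P = 2 * m" "card Z = 2 * m" "\<delta> = 0"
    using sum leZ leP kl r(5) by fastforce+
  have m_pos: "m \<ge> 1" using \<open>P \<noteq> {}\<close> eq finN by (cases m) auto
  obtain p where p: "p \<in> P" using \<open>P \<noteq> {}\<close> by blast
  \<comment> \<open>The misses of \<open>p\<close> fill exactly \<open>Z\<close>, which avoids
    \<open>b\<close>; hence \<open>p\<close> is related to \<open>b\<close> by both \<open>E\<close>
    and \<open>G\<close>. The same argument with \<open>q\<close> and \<open>P\<close> serves for
    \<open>a\<close>.\<close>
  have tp: "{v \<in> B. \<not> E p v} \<union> {v \<in> D. \<not> G p v} = Z" 
    using tight_cover(1)[OF coverZ[OF p]] missE(1)[of p] missG(1)[of p] p fin eq unfolding P_def by auto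
  \<comment> \<open>The misses of \<open>p\<close> in \<open>G\<close> alone number at most
    \<open>m\<close>, fewer than the \<open>2 * m\<close> elements of \<open>Z\<close>.\<close>
  have "\<not> Z \<subseteq> {v \<in> D. \<not> G p v}"
    using card_mono[of "{v \<in> D. \<not> G p v}" Z] fin missG(1)[of p] p eq m_pos unfolding P_def by auto
  then obtain q where q: "q \<in> Z" "G p q" unfolding Z_def by blast
  have tq: "{v \<in> A. \<not> E q v} \<union> {v \<in> C. \<not> G q v} = P"
    using tight_cover(1)[OF coverP[OF q(1)]] missE(2)[of q] missG(2)[of q] q fin eq unfolding Z_def by auto
  have "Ex \<inter> Gx = {}" "a \<notin> Gx" "a \<notin> Ey" "b \<notin> Ex" "b \<notin> Gy"
    using eq(3) finN unfolding \<delta>_def by auto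
  then have "E x y \<or> G x y" "G x a" "E y a" "E x b" "G y b"
    unfolding defs using a b x y by auto
  moreover have "E p b" "G p b"
    using tp b unfolding Z_def by auto
  moreover have "E q a" "G q a"
    using tq a unfolding P_def by auto
  ultimately show ?thesis
    using that[of p q] p q symE symG unfolding P_def Z_def by blast
qed

text \<open>The joint neighbours \<open>Z\<close> of \<open>a\<close> and \<open>P\<close> of
  \<open>b\<close> number at least \<open>2 * m + 1\<close> each, whereas a vertex fails to be
  joined in both relations to at most \<open>2 * m\<close> vertices across. So every element of
  \<open>P\<close> has a joint neighbour in \<open>Z\<close> and conversely. A second one gives
  \<open>row\<close> or \<open>column\<close>; otherwise joint adjacency is a perfect matching
  between \<open>P\<close> and \<open>Z\<close>, all bounds are equalities, and two matched pairs
  \<open>p, s\<close> and \<open>t, q\<close> give \<open>tight\<close>.\<close>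

lemma aligned_alternatives:
  assumes E: "nearly_complete A B m E" and G: "nearly_complete A B m G"
    and r: "card A = r" "card B = r" "4 * m + 1 \<le> r"
    and a: "a \<in> A" and b: "b \<in> B" and ab: "\<not> G a b"
  obtains
    (row) p q s where "distinct [a, p, b, q, s]" "E a q" "E a s" "E p b" "E p q" "E p s"
      "G a q" "G a s" "G p b" "G p q" "G p s"
  | (column) p s q where "distinct [b, q, a, p, s]" "E p b" "E s b" "E a q" "E p q" "E s q"
      "G p b" "G s b" "G a q" "G p q" "G s q"
  | (tight) p t q s where "distinct [a, p, t, b, q, s]"
      "E a q" "E a s" "E p b" "E p s" "E t b" "E t q"
      "G a q" "G a s" "G p b" "G p q" "G p s" "G t b" "G t q" "E t s \<or> G t s"
proof -
  have fin: "finite A" "finite B" and disj: "A \<inter> B = {}"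
    and symE: "\<And>u v. E u v \<Longrightarrow> E v u" and symG: "\<And>u v. G u v \<Longrightarrow> G v u"
    and miss: "\<And>u. u \<in> A \<Longrightarrow> card {v \<in> B. \<not> E u v} \<le> m" "\<And>u. u \<in> B \<Longrightarrow> card {v \<in> A. \<not> E u v} \<le> m"
      "\<And>u. u \<in> A \<Longrightarrow> card {v \<in> B. \<not> G u v} \<le> m" "\<And>u. u \<in> B \<Longrightarrow> card {v \<in> A. \<not> G u v} \<le> m"
    using E G unfolding nearly_complete_def by (auto dest: sympD)
  define H where "H u v \<longleftrightarrow> E u v \<and> G u v" for u v
  define P where "P = {p \<in> A. H p b}"
  define Z where "Z = {q \<in> B. H a q}"
  have finP: "finite P" and finZ: "finite Z" unfolding P_def Z_def using fin by auto
  have ineq: "p \<noteq> q" if "p \<in> A" "q \<in> B" for p q using disj that by blast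
  have neP: "p \<noteq> a" if "p \<in> P" for p using that ab unfolding P_def H_def by blast
  have neZ: "q \<noteq> b" if "q \<in> Z" for q using that ab unfolding Z_def H_def by blast
  have "card B \<le> card (Z \<union> ({v \<in> B. \<not> E a v} \<union> {v \<in> B. \<not> G a v}))"
    unfolding Z_def H_def using fin by (intro card_mono) auto
  also have "\<dots> \<le> card Z + (card {v \<in> B. \<not> E a v} + card {v \<in> B. \<not> G a v})"
    using card_Un_le[of Z "{v \<in> B. \<not> E a v} \<union> {v \<in> B. \<not> G a v}"]
      card_Un_le[of "{v \<in> B. \<not> E a v}" "{v \<in> B. \<not> G a v}"] by linarith
  finally have cardZ: "2 * m + 1 \<le> card Z"
    using miss(1,3)[OF a] r by linarith
  have "card A \<le> card (P \<union> ({v \<in> A. \<not> E b v} \<union> {v \<in> A. \<not> G b v}))"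
    unfolding P_def H_def using fin symE symG by (intro card_mono) auto
  also have "\<dots> \<le> card P + (card {v \<in> A. \<not> E b v} + card {v \<in> A. \<not> G b v})"
    using card_Un_le[of P "{v \<in> A. \<not> E b v} \<union> {v \<in> A. \<not> G b v}"]
      card_Un_le[of "{v \<in> A. \<not> E b v}" "{v \<in> A. \<not> G b v}"] by linarith
  finally have cardP: "2 * m + 1 \<le> card P"
    using miss(2,4)[OF b] r by linarith
  show ?thesis
  proof (cases "\<exists>p\<in>P. \<exists>q\<in>Z. \<exists>s\<in>Z. q \<noteq> s \<and> H p q \<and> H p s")
    case True
    then obtain p q s where "p \<in> P" "q \<in> Z" "s \<in> Z" "q \<noteq> s" "H p q" "H p s" by blast
    with neP neZ ineq a b show ?thesis
      by (intro row[of p q s]) (auto simp: P_def Z_def H_def)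
  next
    case unique_Z: False
    show ?thesis
    proof (cases "\<exists>q\<in>Z. \<exists>p\<in>P. \<exists>s\<in>P. p \<noteq> s \<and> H p q \<and> H s q")
      case True
      then obtain p q s where "q \<in> Z" "p \<in> P" "s \<in> P" "p \<noteq> s" "H p q" "H s q" by blast
      with neP neZ ineq a b show ?thesis
        by (intro column[of q p s]) (auto simp: P_def Z_def H_def)
    next
      case unique_P: False
      have coverZ: "\<exists>s\<in>Z. H p s \<and> Z - {s} \<subseteq> {v \<in> B. \<not> E p v} \<union> {v \<in> B. \<not> G p v} \<and> card (Z - {s}) = 2 * m"
        if p: "p \<in> P" for p
      proof -
        have "p \<in> A" using p by (simp add: P_def)
        note le = card_le_of_cover[OF _ _ _ miss(1,3)[OF this]]
        have "\<not> Z \<subseteq> {v \<in> B. \<not> E p v} \<union> {v \<in> B. \<not> G p v}"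
          using le[of Z] fin cardZ by auto
        then obtain s where s: "s \<in> Z" "H p s" unfolding Z_def H_def by blast
        then have sub: "Z - {s} \<subseteq> {v \<in> B. \<not> E p v} \<union> {v \<in> B. \<not> G p v}"
          using unique_Z p unfolding Z_def H_def by blast
        moreover have "card (Z - {s}) = 2 * m"
          using le[OF sub] fin s(1) finZ cardZ by auto
        ultimately show ?thesis using s by blast
      qed
      have coverP: "\<exists>p\<in>P. H p q" if q: "q \<in> Z" for q
      proof -
        have "q \<in> B" using q by (simp add: Z_def)
        have "\<not> P \<subseteq> {v \<in> A. \<not> E q v} \<union> {v \<in> A. \<not> G q v}"
          using card_le_of_cover[OF _ _ _ miss(2,4)[OF \<open>q \<in> B\<close>], of P] fin cardP by auto
        then show ?thesis unfolding P_def H_def using symE symG by blast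
      qed
      \<comment> \<open>The missing pair \<open>a, b\<close> excludes \<open>m = 0\<close>. With
        \<open>m < 2 * m\<close>, some \<open>q\<close> other than the partner \<open>s\<close> of
        \<open>p\<close> still satisfies \<open>G p q\<close>.\<close>
      have "b \<in> {v \<in> B. \<not> G a v}" using ab b by blast
      then have "card {v \<in> B. \<not> G a v} > 0" using fin by (auto simp: card_gt_0_iff)
      then have m_pos: "m \<ge> 1" using miss(3)[OF a] by linarith
      have "P \<noteq> {}" using cardP by auto
      then obtain p where p: "p \<in> P" by blast
      then have pA: "p \<in> A" by (simp add: P_def)
      obtain s where s: "s \<in> Z" "H p s" "card (Z - {s}) = 2 * m" using coverZ[OF p] by blast
      have "\<not> Z - {s} \<subseteq> {v \<in> B. \<not> G p v}"
        using card_mono[of "{v \<in> B. \<not> G p v}" "Z - {s}"] s(3) miss(3)[OF pA] fin m_pos by auto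
      then obtain q where q: "q \<in> Z" "q \<noteq> s" "G p q" unfolding Z_def by blast
      have "\<not> H p q" using unique_Z p q s by blast
      obtain t where t: "t \<in> P" "H t q" using coverP[OF q(1)] by blast
      have "p \<noteq> t" using t \<open>\<not> H p q\<close> by blast
      obtain q' where q': "q' \<in> Z" "H t q'" 
        and cov: "Z - {q'} \<subseteq> {v \<in> B. \<not> E t v} \<union> {v \<in> B. \<not> G t v}" "card (Z - {q'}) = 2 * m"
        using coverZ[OF t(1)] by blast
      have "q' = q" using unique_Z t q q' by blast
      have tA: "t \<in> A" using t by (simp add: P_def)
      \<comment> \<open>The misses of \<open>t\<close> must cover the \<open>2 * m\<close> elements
        of \<open>Z - {q'}\<close>, so no vertex, in particular not \<open>s\<close>, is missed in
        both relations.\<close>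
      have "{v \<in> B. \<not> E t v} \<inter> {v \<in> B. \<not> G t v} = {}"
        using tight_cover(2)[OF cov(1) _ _ miss(1,3)[OF tA] cov(2)] fin by simp
      then have "E t s \<or> G t s" using s(1) unfolding Z_def by blast
      with p q s t \<open>p \<noteq> t\<close> neP neZ ineq a b show ?thesis
        by (intro tight[of p t q s]) (auto simp: P_def Z_def H_def)
    qed
  qed
qed

section \<open>The exchange property\<close>

lemma nearly_complete_pullback:
  assumes F: "nearly_complete C D m F" and \<sigma>: "bij_betw \<sigma> V (C \<union> D)"
  shows "nearly_complete {x \<in> V. \<sigma> x \<in> C} {x \<in> V. \<sigma> x \<in> D} m (\<lambda>x y. F (\<sigma> x) (\<sigma> y))"
proof -
  have inj: "inj_on \<sigma> V" and fin: "finite V"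
    using \<sigma> F bij_betw_finite[OF \<sigma>] by (auto simp: bij_betw_def nearly_complete_def)
  have miss: "card {y \<in> {x \<in> V. \<sigma> x \<in> S}. \<not> F u (\<sigma> y)} \<le> card {v \<in> S. \<not> F u v}"
    if "finite S" for S u
    using that by (intro card_inj_on_le[OF inj_on_subset[OF inj]]) auto
  have "card {y \<in> {x \<in> V. \<sigma> x \<in> S}. \<not> F u (\<sigma> y)} \<le> m"
    if "finite S" "card {v \<in> S. \<not> F u v} \<le> m" for S u
    using miss[OF that(1), of u] that(2) by linarith
  with F fin show ?thesis
    unfolding nearly_complete_def by (auto simp: symp_def)
qed

text \<open>Swaps that avoid \<open>a\<close> and \<open>b\<close> commute with interchanging these
  two. A preparation can therefore be replayed, or undone, after the exchange.\<close>

lemma fs_reach_conjugate: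
  assumes "fs_reach (\<lambda>x y. E x y \<and> x \<in> V - {a, b} \<and> y \<in> V - {a, b}) F \<sigma> \<tau>"
  shows "fs_reach E F \<sigma> \<tau>" "fs_reach E F (\<sigma> \<circ> transpose a b) (\<tau> \<circ> transpose a b)"
    "\<tau> a = \<sigma> a" "\<tau> b = \<sigma> b"
  using assms
proof (induction rule: fs_reach.induct)
  case (refl \<sigma>)
  case 1 show ?case by (rule fs_reach.refl)
  case 2 show ?case by (rule fs_reach.refl)
next
  case (step \<sigma> \<tau> c d)
  have cd: "c \<noteq> a" "c \<noteq> b" "d \<noteq> a" "d \<noteq> b" and "E c d" using step by auto
  case 1
  show ?case using step.IH(1) \<open>E c d\<close> step.hyps(3) by (rule fs_reach.step)
  case 2
  have "fs_reach E F (\<sigma> \<circ> transpose a b) (\<tau> \<circ> transpose a b \<circ> transpose c d)"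
    using step.IH(2) \<open>E c d\<close> by (rule fs_reach.step) (use step.hyps(3) cd in simp)
  also have "\<tau> \<circ> transpose a b \<circ> transpose c d = \<tau> \<circ> transpose c d \<circ> transpose a b"
    using cd by (auto simp: fun_eq_iff transpose_def)
  finally show ?case .
  case 3 show ?case using step.IH(3) cd by simp
  case 4 show ?case using step.IH(4) cd by simp
qed auto

lemma fs_reach_bij_betw:
  assumes "fs_reach E F \<sigma> \<tau>" "\<And>x y. E x y \<Longrightarrow> x \<in> V \<and> y \<in> V" "bij_betw \<sigma> V W"
  shows "bij_betw \<tau> V W"
  using assms(1,3)
proof (induction rule: fs_reach.induct)
  case (step \<sigma> \<tau> a b)
  have "bij_betw (transpose a b) V V"
    using assms(2)[OF step(2)] by simp
  from bij_betw_trans[OF this step.IH[OF step.prems]] show ?case .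
qed

lemma fs_reach_exchange_aligned:
  assumes E: "nearly_complete A B m E" and F: "symp F"
    and G: "nearly_complete A B m (\<lambda>x y. F (\<tau> x) (\<tau> y))"
    and r: "card A = r" "card B = r" "4 * m + 1 \<le> r"
    and ab: "a \<in> A" "b \<in> B" "E a b" "\<not> F (\<tau> a) (\<tau> b)"
  shows "fs_reach E F \<tau> (\<tau> \<circ> transpose a b)"
proof -
  have symE: "E y x" if "E x y" for x y
    using E that unfolding nearly_complete_def by (auto dest: sympD)
  have symF: "F (\<tau> y) (\<tau> x)" if "F (\<tau> x) (\<tau> y)" for x y
    using F that by (rule sympD)
  show ?thesis
  proof (rule aligned_alternatives[OF E G r ab(1,2,4)])
    fix p q s
    assume "distinct [a, p, b, q, s]" "E a q" "E a s" "E p b" "E p q" "E p s"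
      "F (\<tau> a) (\<tau> q)" "F (\<tau> a) (\<tau> s)" "F (\<tau> p) (\<tau> b)" "F (\<tau> p) (\<tau> q)" "F (\<tau> p) (\<tau> s)"
    with ab(3) show ?thesis by (intro swap_gadget_23[OF F, of a p b q s])
  next
    fix p s q
    assume "distinct [b, q, a, p, s]" "E p b" "E s b" "E a q" "E p q" "E s q"
      "F (\<tau> p) (\<tau> b)" "F (\<tau> s) (\<tau> b)" "F (\<tau> a) (\<tau> q)" "F (\<tau> p) (\<tau> q)" "F (\<tau> s) (\<tau> q)"
    \<comment> \<open>The gadget for \<open>row\<close> is used with the two sides
      interchanged.\<close>
    with ab(3) have "fs_reach E F \<tau> (\<tau> \<circ> transpose b a)"
      by (intro swap_gadget_23[OF F, of b q a p s])
        (assumption | rule symE, assumption | rule symF, assumption)+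
    then show ?thesis by (simp only: transpose_commute)
  next
    fix p t q s
    assume tight: "distinct [a, p, t, b, q, s]"
      "E a q" "E a s" "E p b" "E p s" "E t b" "E t q"
      "F (\<tau> a) (\<tau> q)" "F (\<tau> a) (\<tau> s)" "F (\<tau> p) (\<tau> b)" "F (\<tau> p) (\<tau> q)" "F (\<tau> p) (\<tau> s)"
      "F (\<tau> t) (\<tau> b)" "F (\<tau> t) (\<tau> q)" "E t s \<or> F (\<tau> t) (\<tau> s)"
    show ?thesis
    proof (cases "F (\<tau> t) (\<tau> s)")
      case True
      then show ?thesis using tight ab(3) by (intro swap_gadget_33_A[OF F, of a p t b q s])
    next
      case False
      with tight(15) have "E t s" by blast
      then show ?thesis using tight ab(3) by (intro swap_gadget_33_B[OF F, of a p t b q s])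
    qed
  qed
qed

lemma fs_reach_exchange:
  assumes E: "nearly_complete A B m E" and F: "nearly_complete C D m F"
    and r: "card A = r" "card B = r" "card C = r" "card D = r" "4 * m + 1 \<le> r"
    and \<sigma>: "bij_betw \<sigma> (A \<union> B) (C \<union> D)"
    and ab: "a \<in> A" "b \<in> B" "E a b" "\<sigma> a \<in> C" "\<sigma> b \<in> D"
  shows "fs_reach E F \<sigma> (\<sigma> \<circ> transpose a b)"
proof (cases "F (\<sigma> a) (\<sigma> b)")
  case True
  then show ?thesis using ab(3) by (intro fs_reach_swap)
next
  case nF: False
  have fin: "finite A" "finite B" "finite C" "finite D" and disj: "A \<inter> B = {}" "C \<inter> D = {}"
    and sF: "symp F"
    using E F unfolding nearly_complete_def by auto
  define V where "V = A \<union> B"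
  define E' where "E' = (\<lambda>x y. E x y \<and> x \<in> V - {a, b} \<and> y \<in> V - {a, b})"
  define f where "f \<tau> = card {x \<in> A. \<tau> x \<in> D}" for \<tau>
  \<comment> \<open>Minimality of the number of misplaced people is what later excludes the moves in
    \<open>block\<close> and \<open>hop\<close>.\<close>
  obtain \<tau> where \<tau>: "fs_reach E' F \<sigma> \<tau>" and min: "\<And>\<upsilon>. fs_reach E' F \<sigma> \<upsilon> \<Longrightarrow> f \<tau> \<le> f \<upsilon>"
    using ex_has_least_nat[of "fs_reach E' F \<sigma>" \<sigma> f] fs_reach.refl[of E' F \<sigma>] by blast
  note conj = fs_reach_conjugate[OF \<tau>[unfolded E'_def]]
  have bij: "bij_betw \<tau> V (C \<union> D)"
    by (rule fs_reach_bij_betw[OF \<tau> _ \<sigma>[folded V_def]]) (simp add: E'_def)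
  then have im: "\<tau> ` V = C \<union> D" by (simp add: bij_betw_def)
  define C' where "C' = {x \<in> V. \<tau> x \<in> C}"
  define D' where "D' = {x \<in> V. \<tau> x \<in> D}"
  \<comment> \<open>People are named by their positions under \<open>\<tau>\<close>, which turns
    both graphs into relations on one set.\<close>
  define G where "G = (\<lambda>x y. F (\<tau> x) (\<tau> y))"
  have G: "nearly_complete C' D' m G"
    unfolding C'_def D'_def G_def by (rule nearly_complete_pullback[OF F bij])
  have V: "A \<union> B = C' \<union> D'"
    using im unfolding C'_def D'_def V_def by auto
  have preimage: "card {x \<in> V. \<tau> x \<in> S} = card S" if "S \<subseteq> C \<union> D" for S
  proof (rule bij_betw_same_card)
    have "S \<subseteq> \<tau> ` {x \<in> V. \<tau> x \<in> S}"
    proof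
      fix s assume "s \<in> S"
      with that im have "s \<in> \<tau> ` V" by blast
      with \<open>s \<in> S\<close> show "s \<in> \<tau> ` {x \<in> V. \<tau> x \<in> S}" by auto
    qed
    then have "\<tau> ` {x \<in> V. \<tau> x \<in> S} = S" by auto
    moreover have "inj_on \<tau> {x \<in> V. \<tau> x \<in> S}"
      using bij unfolding bij_betw_def by (auto elim: inj_on_subset)
    ultimately show "bij_betw \<tau> {x \<in> V. \<tau> x \<in> S} S" by (simp add: bij_betw_def)
  qed
  have cards: "card C' = r" "card D' = r"
    unfolding C'_def D'_def using preimage[of C] preimage[of D] r by auto
  have mem: "a \<in> C'" "b \<in> D'"
    unfolding C'_def D'_def V_def using ab conj(3,4) by auto
  have AD: "{x \<in> A. \<tau> x \<in> D} = A \<inter> D'" unfolding D'_def V_def by auto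
  have finC': "finite C'" and finD': "finite D'" and disj': "C' \<inter> D' = {}"
    using G unfolding nearly_complete_def by blast+
  have "fs_reach E F \<tau> (\<tau> \<circ> transpose a b)"
  proof (cases "A \<inter> D' = {}")
    case True
    then have "A \<subseteq> C'" using V by blast
    then have "A = C'" using cards r card_subset_eq[OF finC'] by simp
    then have "B = D'" using V disj disj' by blast
    show ?thesis
      using G nF conj(3,4) ab unfolding \<open>A = C'\<close>[symmetric] \<open>B = D'\<close>[symmetric] G_def
      by (intro fs_reach_exchange_aligned[OF E sF _ r(1,2,5)]) simp_all
  next
    case False
    then obtain x where x: "x \<in> A" "x \<in> D'" by blast
    have "\<not> B \<subseteq> D'"
    proof
      assume "B \<subseteq> D'"
      then have "B = D'" using cards r card_subset_eq[OF finD'] by simp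
      with x disj show False by blast
    qed
    then obtain y where y: "y \<in> B" "y \<in> C'" using V by blast
    have smaller: False if "fs_reach E' F \<tau> \<upsilon>" "{z \<in> A. \<upsilon> z \<in> D} \<subseteq> A \<inter> D' - {x'}" "x' \<in> A \<inter> D'" for \<upsilon> x'
    proof -
      have "f \<upsilon> \<le> card (A \<inter> D' - {x'})"
        unfolding f_def using that(2) fin by (intro card_mono) auto
      also have "\<dots> < f \<tau>"
        unfolding f_def AD using that(3) fin by (intro psubset_card_mono) auto
      finally show False using min[OF fs_reach_trans[OF \<tau> that(1)]] by linarith
    qed
    have E'I: "E' u v" if "E u v" "u \<in> V" "v \<in> V" "u \<noteq> a" "u \<noteq> b" "v \<noteq> a" "v \<noteq> b" for u v
      using that unfolding E'_def by simp
    have block: False if "x \<in> A \<inter> D'" "y \<in> B \<inter> C'" "E x y" "G x y" for x y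
    proof (rule smaller)
      show "fs_reach E' F \<tau> (\<tau> \<circ> transpose x y)"
        using that mem disj ab disj' unfolding G_def
        by (intro fs_reach_swap E'I) (auto simp: V_def)
      show "{z \<in> A. (\<tau> \<circ> transpose x y) z \<in> D} \<subseteq> A \<inter> D' - {x}"
        using that disj \<open>C \<inter> D = {}\<close> unfolding C'_def D'_def V_def transpose_def by auto
    qed (use that in blast)
    have hop: False if pq: "p \<in> A \<inter> C' - {a}" "q \<in> B \<inter> D' - {b}" "E p q" "G p q" "E x q" "G p x" "E p y" "G q y"
      for p q
    proof -
      have ne: "x \<noteq> a" "x \<noteq> b" "y \<noteq> a" "y \<noteq> b" "p \<noteq> a" "p \<noteq> b" "q \<noteq> a" "q \<noteq> b"
        "p \<noteq> x" "q \<noteq> y" "p \<noteq> q" "x \<noteq> y" "p \<noteq> y" "x \<noteq> q"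
        using pq(1,2) x y mem disj ab disj' by auto
      have inV: "x \<in> V" "y \<in> V" "p \<in> V" "q \<in> V" using pq(1,2) x y by (auto simp: V_def)
      \<comment> \<open>After the three swaps, \<open>x\<close> holds the person from
        \<open>p\<close>, \<open>p\<close> the one from \<open>y\<close>, \<open>q\<close> the one
        from \<open>x\<close>, and \<open>y\<close> the one from \<open>q\<close>. All four
        positions are then aligned.\<close>
      have "legal_swaps E' F [(p, q), (x, q), (p, y)] \<tau>"
        using pq ne ne[symmetric] inV symp_def[of F] sF unfolding G_def by (auto intro!: E'I)
      from fs_reach_swaps[OF this] have "fs_reach E' F \<tau> (\<tau> \<circ> swaps [(p, q), (x, q), (p, y)])" .
      moreover have "{z \<in> A. (\<tau> \<circ> swaps [(p, q), (x, q), (p, y)]) z \<in> D} \<subseteq> A \<inter> D' - {x}"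
      proof
        fix z assume "z \<in> {z \<in> A. (\<tau> \<circ> swaps [(p, q), (x, q), (p, y)]) z \<in> D}"
        then have z: "z \<in> A" "\<tau> (swaps [(p, q), (x, q), (p, y)] z) \<in> D" by auto
        have yD: "\<tau> y \<notin> D" and pD: "\<tau> p \<notin> D"
          using y pq(1) disj unfolding C'_def by auto
        have "z \<noteq> p" using z(2) yD ne ne[symmetric] by auto
        moreover have "z \<noteq> x" using z(2) pD ne ne[symmetric] by auto
        moreover have "z \<noteq> q" "z \<noteq> y" using z(1) pq(2) y(1) disj by auto
        ultimately have "swaps [(p, q), (x, q), (p, y)] z = z" by simp
        with z \<open>z \<noteq> x\<close> show "z \<in> A \<inter> D' - {x}" unfolding D'_def V_def by simp
      qed
      ultimately show False using smaller x by blast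
    qed
    have symG: "G v u" if "G u v" for u v using that sF unfolding G_def by (auto dest: sympD)
    show ?thesis
    proof (rule not_all_aligned_alternatives
        [OF E G V r(1,2) cards r(5) ab(1) mem(1) ab(2) mem(2) x y block hop])
      fix p q
      assume pq: "p \<in> A \<inter> C' - {a}" "q \<in> B \<inter> D' - {b}"
        "E a q" "E a y" "E p b" "E p y" "E x b" "E x q"
        "G a x" "G a q" "G p b" "G p x" "G p q" "G y b" "G y q" "E x y \<or> G x y"
      have d: "distinct [a, p, x, b, q, y]"
        using pq(1,2) x y mem ab disj disj' by auto
      show ?thesis
      proof (cases "E x y")
        case True
        then show ?thesis
          using pq ab(3) unfolding G_def by (intro swap_gadget_33_C[OF sF d])
      next
        case False
        then have "G y x" using pq(16) symG by blast
        then show ?thesis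
          using pq ab(3) unfolding G_def by (intro swap_gadget_33_D[OF sF d])
      qed
    qed
  qed
  \<comment> \<open>The preparation is run backwards with the people at \<open>a\<close> and
    \<open>b\<close> interchanged.\<close>
  also have "fs_reach E F (\<tau> \<circ> transpose a b) (\<sigma> \<circ> transpose a b)"
    using conj(2) sF by (rule fs_reach_sym)
  finally show ?thesis using conj(1) fs_reach_trans by blast
qed

section \<open>Complete bipartite graphs\<close>

definition complete_adj :: "'a set \<Rightarrow> 'a set \<Rightarrow> 'a \<Rightarrow> 'a \<Rightarrow> bool" where
  "complete_adj A B x y \<longleftrightarrow> x \<in> A \<and> y \<in> B \<or> x \<in> B \<and> y \<in> A"

lemma complete_adj_commute: "complete_adj A B = complete_adj B A"
  by (auto simp: complete_adj_def fun_eq_iff)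

lemma nearly_complete_complete_adj:
  assumes "finite A" "finite B" "A \<inter> B = {}"
  shows "nearly_complete A B m (complete_adj A B)"
proof -
  have "{y \<in> B. \<not> complete_adj A B x y} = {}" if "x \<in> A" for x
    using that by (auto simp: complete_adj_def)
  then have "card {y \<in> B. \<not> complete_adj A B x y} \<le> m" if "x \<in> A" for x
    using that by (simp only: card.empty le0)
  moreover have "{x \<in> A. \<not> complete_adj A B y x} = {}" if "y \<in> B" for y
    using that by (auto simp: complete_adj_def)
  then have "card {x \<in> A. \<not> complete_adj A B y x} \<le> m" if "y \<in> B" for y
    using that by (simp only: card.empty le0)
  moreover have "symp (complete_adj A B)"
    by (auto simp: symp_def complete_adj_def)
  ultimately show ?thesis
    using assms unfolding nearly_complete_def by simp
qed

text \<open>Each swap allowed by the complete graph concerns people from opposite sides at adjacent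
  positions, which is what \<open>fs_reach_exchange\<close> simulates. The possible orientations
  reduce to one by renaming \<open>C\<close> and \<open>D\<close>, or \<open>x\<close> and
  \<open>y\<close>.\<close>

lemma fs_reach_complete_target:
  assumes "fs_reach E (complete_adj C D) \<sigma> \<tau>"
    and E: "nearly_complete A B m E" and F: "nearly_complete C D m F"
    and r: "card A = r" "card B = r" "card C = r" "card D = r" "4 * m + 1 \<le> r"
    and \<sigma>: "bij_betw \<sigma> (A \<union> B) (C \<union> D)"
    and bip: "\<And>x y. E x y \<Longrightarrow> complete_adj A B x y"
  shows "fs_reach E F \<sigma> \<tau>"
  using assms(1) \<sigma>
proof (induction rule: fs_reach.induct)
  case (refl \<sigma>)
  show ?case by (rule fs_reach.refl)
next
  case (step \<sigma> \<tau> x y)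
  have bij: "bij_betw \<tau> (A \<union> B) (C \<union> D)"
    using bip by (intro fs_reach_bij_betw[OF step(1) _ step.prems]) (auto simp: complete_adj_def)
  have exch: "fs_reach E F \<tau> (\<tau> \<circ> transpose x y)"
    if "x \<in> A" "y \<in> B" "E x y" "complete_adj C D (\<tau> x) (\<tau> y)" for x y
  proof (cases "\<tau> x \<in> C \<and> \<tau> y \<in> D")
    case True
    then show ?thesis using fs_reach_exchange[OF E F r bij that(1-3)] by blast
  next
    case False
    then have "\<tau> x \<in> D" "\<tau> y \<in> C" using that(4) by (auto simp: complete_adj_def)
    then show ?thesis
      using fs_reach_exchange[OF E F[THEN nearly_complete_commute[THEN iffD1]] r(1,2,4,3,5) _ that(1-3)]
        bij by (simp add: Un_commute)
  qed
  have "fs_reach E F \<tau> (\<tau> \<circ> transpose x y)"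
  proof (cases "x \<in> A \<and> y \<in> B")
    case True
    then show ?thesis using exch step(2,3) by blast
  next
    case False
    then have "x \<in> B" "y \<in> A" using bip[OF step(2)] by (auto simp: complete_adj_def)
    moreover have "E y x" using E step(2) unfolding nearly_complete_def by (blast dest: sympD)
    moreover have "complete_adj C D (\<tau> y) (\<tau> x)" using step(3) by (auto simp: complete_adj_def)
    ultimately have "fs_reach E F \<tau> (\<tau> \<circ> transpose y x)" by (intro exch)
    then show ?thesis by (simp only: transpose_commute)
  qed
  with step.IH[OF step.prems] show ?case by (rule fs_reach_trans)
qed

text \<open>Seen from the inverse, swapping the people at \<open>a\<close> and \<open>b\<close>
  swaps the positions of \<open>\<tau> a\<close> and \<open>\<tau> b\<close>. So the two graphs
  trade roles.\<close>

lemma fs_reach_inv: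
  assumes "fs_reach E F \<sigma> \<tau>" "bij \<sigma>"
  shows "bij \<tau>" "fs_reach F E (inv \<sigma>) (inv \<tau>)"
  using assms
proof (induction rule: fs_reach.induct)
  case (refl \<sigma>)
  case 1 then show ?case .
  case 2 show ?case by (rule fs_reach.refl)
next
  case (step \<sigma> \<tau> a b)
  case 1
  show ?case using step.IH(1)[OF 1] bij_transpose by (intro bij_comp)
  case 2
  have bij: "bij \<tau>" using step.IH(1) 2 .
  have "fs_reach F E (inv \<sigma>) (inv \<tau> \<circ> transpose (\<tau> a) (\<tau> b))"
    using step.IH(2)[OF 2] step(3) by (rule fs_reach.step) (use step(2) bij in \<open>simp add: bij_is_inj\<close>)
  also have "inv \<tau> \<circ> transpose (\<tau> a) (\<tau> b) = inv (\<tau> \<circ> transpose a b)"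
    using bij transpose_comp_eq[OF bij_imp_bij_inv[OF bij], of a b]
    by (simp add: o_inv_distrib inv_inv_eq)
  finally show ?case .
qed

text \<open>The graph of people is thinned out first, with positions still complete; passing to
  inverses, the same result thins out the graph of positions.\<close>

lemma fs_reach_of_complete:
  assumes E: "nearly_complete A B m E" "\<And>x y. E x y \<Longrightarrow> complete_adj A B x y"
    and F: "nearly_complete A B m F" "\<And>x y. F x y \<Longrightarrow> complete_adj A B x y"
    and r: "card A = r" "card B = r" "4 * m + 1 \<le> r"
    and \<sigma>: "\<sigma> permutes A \<union> B"
    and reach: "fs_reach (complete_adj A B) (complete_adj A B) \<sigma> \<tau>"
  shows "fs_reach E F \<sigma> \<tau>"
proof -
  have K: "nearly_complete A B m (complete_adj A B)"
    using E by (intro nearly_complete_complete_adj) (simp_all add: nearly_complete_def)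
  note r' = r(1,2,1,2,3)
  have bij: "bij \<sigma>" using \<sigma> by (rule permutes_bij)
  have "fs_reach (complete_adj A B) F \<sigma> \<tau>"
    using fs_reach_complete_target[OF reach K F(1) r' permutes_imp_bij[OF \<sigma>]] by blast
  from fs_reach_inv[OF this bij] have \<tau>: "bij \<tau>" "fs_reach F (complete_adj A B) (inv \<sigma>) (inv \<tau>)" .
  have "fs_reach F E (inv \<sigma>) (inv \<tau>)"
    using fs_reach_complete_target[OF \<tau>(2) F(1) E(1) r' permutes_imp_bij[OF permutes_inv[OF \<sigma>]]] F(2)
    by blast
  from fs_reach_inv(2)[OF this bij_imp_bij_inv[OF bij]] bij \<tau>(1) show ?thesis
    by (simp add: inv_inv_eq)
qed

text \<open>The basic move between aligned arrangements: using each edge of the four-cycle on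
  \<open>p, q, p', q'\<close> once interchanges one pair on each side.\<close>

lemma fs_reach_double_swap:
  assumes "A \<inter> B = {}" "\<rho> ` A \<subseteq> A" "\<rho> ` B \<subseteq> B"
    and "p \<in> A" "p' \<in> A" "p \<noteq> p'" "q \<in> B" "q' \<in> B" "q \<noteq> q'"
  shows "fs_reach (complete_adj A B) (complete_adj A B) \<rho> (\<rho> \<circ> transpose p p' \<circ> transpose q q')"
proof -
  let ?l = "[(p, q), (p', q'), (p', q), (p, q')]"
  have ne: "p \<noteq> q" "p \<noteq> q'" "p' \<noteq> q" "p' \<noteq> q'" using assms by auto
  have mem: "\<rho> p \<in> A" "\<rho> p' \<in> A" "\<rho> q \<in> B" "\<rho> q' \<in> B" using assms by auto
  have "legal_swaps (complete_adj A B) (complete_adj A B) ?l \<rho>"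
    using assms(4-) mem ne ne[symmetric] by (simp add: complete_adj_def)
  from fs_reach_swaps[OF this]
  have "fs_reach (complete_adj A B) (complete_adj A B) \<rho> (\<rho> \<circ> swaps ?l)" .
  also have "swaps ?l = transpose p p' \<circ> transpose q q'"
    using assms(6,9) ne by (auto simp: fun_eq_iff transpose_def)
  finally show ?thesis by (simp only: o_assoc)
qed

lemma permutes_comp_commute:
  assumes "f permutes A" "g permutes B" "A \<inter> B = {}"
  shows "f \<circ> g = g \<circ> f"
proof
  fix x
  have f: "f y = y" if "y \<notin> A" for y using permutes_not_in[OF assms(1) that] .
  have g: "g y = y" if "y \<notin> B" for y using permutes_not_in[OF assms(2) that] .
  have "f x \<notin> B" if "x \<in> A"
    using that assms(3) permutes_in_image[OF assms(1), of x] by blast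
  moreover have "g x \<notin> A" if "x \<in> B"
    using that assms(3) permutes_in_image[OF assms(2), of x] by blast
  ultimately show "(f \<circ> g) x = (g \<circ> f) x"
    using f g assms(3) by (cases "x \<in> A"; cases "x \<in> B") auto
qed

text \<open>Write \<open>g\<close> as a product of transpositions. A double swap removes one of them
  at the price of interchanging \<open>c\<close> and \<open>c'\<close>, so only the parity of the
  number of factors is left over.\<close>

lemma fs_reach_cancel_permutation:
  assumes g: "finite B" "g permutes B" and AB: "A \<inter> B = {}"
    and \<rho>: "\<rho> ` A \<subseteq> A" "\<rho> ` B \<subseteq> B"
    and c: "c \<in> A" "c' \<in> A" "c \<noteq> c'"
  shows "fs_reach (complete_adj A B) (complete_adj A B) (\<rho> \<circ> g) \<rho> \<or>
    fs_reach (complete_adj A B) (complete_adj A B) (\<rho> \<circ> g) (\<rho> \<circ> transpose c c')"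
    (is "?R (\<rho> \<circ> g) \<rho> \<or> _")
  using g \<rho>
proof (induction arbitrary: \<rho> rule: permutes_rev_induct)
  case id
  show ?case using fs_reach.refl[of "complete_adj A B" "complete_adj A B" \<rho>] by simp
next
  case (swap a b p)
  let ?\<rho> = "\<rho> \<circ> transpose c c'"
  have t: "transpose c c' permutes A" using c by (intro permutes_swap_id)
  have im: "?\<rho> ` A \<subseteq> A" "?\<rho> ` B \<subseteq> B"
  proof -
    have "?\<rho> ` A = \<rho> ` (transpose c c' ` A)" by (rule image_comp[symmetric])
    then show "?\<rho> ` A \<subseteq> A" using swap.prems(1) by (simp only: permutes_image[OF t])
    have "transpose c c' y = y" if "y \<in> B" for y using that AB c by (intro transpose_apply_other) auto
    then show "?\<rho> ` B \<subseteq> B" using swap.prems(2) by auto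
  qed
  have p: "p ` B = B" "p ` A \<subseteq> A"
    using permutes_image[OF swap.hyps(4)] permutes_not_in[OF swap.hyps(4)] AB by auto
  have "?R (\<rho> \<circ> (p \<circ> transpose a b)) (\<rho> \<circ> (p \<circ> transpose a b) \<circ> transpose c c' \<circ> transpose a b)"
  proof (rule fs_reach_double_swap[OF AB])
    show "(\<rho> \<circ> (p \<circ> transpose a b)) ` A \<subseteq> A" "(\<rho> \<circ> (p \<circ> transpose a b)) ` B \<subseteq> B"
      using swap(1,2) swap.prems p AB by (auto simp: image_subset_iff transpose_def)
  qed (use c swap in auto)
  also have "\<rho> \<circ> (p \<circ> transpose a b) \<circ> transpose c c' \<circ> transpose a b = ?\<rho> \<circ> p"
  proof -
    have "transpose a b \<circ> transpose c c' = transpose c c' \<circ> transpose a b"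
      using permutes_comp_commute[OF t permutes_swap_id[OF swap(1,2)] AB] by simp
    moreover have "p \<circ> transpose c c' = transpose c c' \<circ> p"
      using permutes_comp_commute[OF t swap.hyps(4) AB] by simp
    ultimately show ?thesis
      by (simp add: fun_eq_iff)
  qed
  finally have reach: "?R (\<rho> \<circ> (p \<circ> transpose a b)) (?\<rho> \<circ> p)" .
  \<comment> \<open>A second interchange of \<open>c\<close> and \<open>c'\<close> undoes the first,
    so the induction stays within the two outcomes.\<close>
  have "?\<rho> \<circ> transpose c c' = \<rho>" by (simp add: o_assoc[symmetric])
  with swap.IH[OF im] reach fs_reach_trans show ?case by metis
qed

text \<open>If somebody from \<open>B\<close> stands in \<open>A\<close>, then
  \<open>\<sigma>\<close> cannot map \<open>B\<close> into itself, as by finiteness it would map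
  \<open>B\<close> onto itself. So somebody from \<open>A\<close> stands in \<open>B\<close>, and
  swapping the two lowers the number of misplaced people.\<close>

lemma fs_reach_complete_aligned:
  assumes "finite A" "finite B" "A \<inter> B = {}" "card A = card B" "\<sigma> permutes A \<union> B"
  obtains \<tau> where "fs_reach (complete_adj A B) (complete_adj A B) \<sigma> \<tau>" "\<tau> permutes A \<union> B" "\<tau> ` A \<subseteq> A"
  using assms(5)
proof (induction "card {x \<in> A. \<sigma> x \<in> B}" arbitrary: \<sigma> thesis rule: less_induct)
  case less
  show ?case
  proof (cases "\<sigma> ` A \<subseteq> A")
    case True
    with less.prems fs_reach.refl show ?thesis by blast
  next
    case False
    then obtain x where x: "x \<in> A" "\<sigma> x \<notin> A" by blast
    then have xB: "\<sigma> x \<in> B" using permutes_in_image[OF less.prems(2), of x] by auto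
    have "\<not> \<sigma> ` B \<subseteq> B"
    proof
      assume "\<sigma> ` B \<subseteq> B"
      then have "\<sigma> ` B = B"
        using permutes_inj_on[OF less.prems(2)] assms(2) by (intro endo_inj_surj)
      then obtain y where "y \<in> B" "\<sigma> y = \<sigma> x" using xB by force
      then have "y = x" using permutes_inj[OF less.prems(2)] by (auto dest: injD)
      with \<open>y \<in> B\<close> x assms(3) show False by blast
    qed
    then obtain y where y: "y \<in> B" "\<sigma> y \<notin> B" by blast
    then have yA: "\<sigma> y \<in> A" using permutes_in_image[OF less.prems(2), of y] by auto
    let ?\<upsilon> = "\<sigma> \<circ> transpose x y"
    have reach: "fs_reach (complete_adj A B) (complete_adj A B) \<sigma> ?\<upsilon>"
      using x xB y yA by (intro fs_reach_swap) (auto simp: complete_adj_def)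
    have perm: "?\<upsilon> permutes A \<union> B"
      using x y less.prems(2) by (intro permutes_compose permutes_swap_id) auto
    have "{z \<in> A. ?\<upsilon> z \<in> B} \<subseteq> {z \<in> A. \<sigma> z \<in> B} - {x}"
      using x y assms(3) by (auto simp: transpose_def split: if_splits)
    also have "\<dots> \<subset> {z \<in> A. \<sigma> z \<in> B}" using x xB by blast
    finally have "card {z \<in> A. ?\<upsilon> z \<in> B} < card {z \<in> A. \<sigma> z \<in> B}"
      using assms(1) by (intro psubset_card_mono) auto
    from less.hyps[OF this _ perm] obtain \<tau> where
      "fs_reach (complete_adj A B) (complete_adj A B) ?\<upsilon> \<tau>" "\<tau> permutes A \<union> B" "\<tau> ` A \<subseteq> A"
      by blast
    with less.prems(1) fs_reach_trans[OF reach] show ?thesis by blast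
  qed
qed

text \<open>An aligned permutation splits into one of \<open>A\<close> and one of \<open>B\<close>.
  Cancelling the latter leaves a permutation of \<open>A\<close> only; cancelling that with the
  sides interchanged leaves at most the transposition of \<open>b\<close> and
  \<open>b'\<close>.\<close>

lemma fs_reach_complete_normal_form:
  assumes fin: "finite A" "finite B" and AB: "A \<inter> B = {}" and card: "card A = card B"
    and a: "a \<in> A" "a' \<in> A" "a \<noteq> a'" and b: "b \<in> B" "b' \<in> B" "b \<noteq> b'"
    and \<sigma>: "\<sigma> permutes A \<union> B"
  shows "fs_reach (complete_adj A B) (complete_adj A B) \<sigma> id \<or>
    fs_reach (complete_adj A B) (complete_adj A B) \<sigma> (transpose b b')"
    (is "?R \<sigma> id \<or> _")
proof -
  obtain \<tau> where \<tau>: "?R \<sigma> \<tau>" "\<tau> permutes A \<union> B" "\<tau> ` A \<subseteq> A"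
    using fs_reach_complete_aligned[OF fin AB card \<sigma>] by blast
  have inj: "inj \<tau>" using \<tau>(2) by (rule permutes_inj)
  have imA: "\<tau> ` A = A" using \<tau>(3) fin inj by (intro endo_inj_surj) (auto elim: inj_on_subset)
  have imB: "\<tau> ` B = B"
  proof -
    have aux: "Y = B" if "X \<union> Y = A \<union> B" "X \<inter> Y = {}" "X = A" for X Y using that AB by blast
    have "\<tau> ` A \<union> \<tau> ` B = A \<union> B" using permutes_image[OF \<tau>(2)] by (simp add: image_Un)
    moreover have "\<tau> ` A \<inter> \<tau> ` B = {}" using AB inj by (simp add: image_Int[symmetric])
    ultimately show ?thesis using imA by (rule aux)
  qed
  define f where "f x = (if x \<in> A then \<tau> x else x)" for x
  define g where "g x = (if x \<in> B then \<tau> x else x)" for x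
  have f: "f permutes A"
    using imA inj by (intro bij_imp_permutes) (auto simp: f_def bij_betw_def inj_on_def dest: injD)
  have g: "g permutes B"
    using imB inj by (intro bij_imp_permutes) (auto simp: g_def bij_betw_def inj_on_def dest: injD)
  have "\<tau> = f \<circ> g"
    using AB imB permutes_not_in[OF \<tau>(2)] by (auto simp: fun_eq_iff f_def g_def)
  have preserve: "h ` A \<subseteq> A" "h ` B \<subseteq> B" if "h permutes A" for h
    using permutes_image[OF that] permutes_not_in[OF that] AB by auto
  have "?R \<tau> f \<or> ?R \<tau> (f \<circ> transpose a a')"
    unfolding \<open>\<tau> = f \<circ> g\<close> using fs_reach_cancel_permutation[OF fin(2) g AB preserve[OF f] a] .
  then obtain h where h: "h permutes A" "?R \<tau> h"
    using f permutes_compose[OF permutes_swap_id[OF a(1,2)] f] by blast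
  have "?R (id \<circ> h) id \<or> ?R (id \<circ> h) (id \<circ> transpose b b')"
    unfolding complete_adj_commute[of A B]
    by (rule fs_reach_cancel_permutation[OF fin(1) h(1)]) (use AB b in auto)
  then have "?R h id \<or> ?R h (transpose b b')" by (simp only: id_o)
  with \<tau>(1) h(2) fs_reach_trans show ?thesis by metis
qed

section \<open>The parity invariant\<close>

definition fs_parity :: "'a set \<Rightarrow> ('a \<Rightarrow> 'a) \<Rightarrow> int" where
  "fs_parity A \<sigma> = sign \<sigma> * (- 1) ^ card {x \<in> A. \<sigma> x \<in> A}"

text \<open>A legal swap flips both factors. Positions and people both come from opposite sides, so
  the two people are either both right or both wrong before the swap, and the count on
  \<open>A\<close> changes by exactly one.\<close>

lemma fs_parity_reach:
  assumes "fs_reach E F \<sigma> \<tau>" and fin: "finite A" "finite B" and AB: "A \<inter> B = {}"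
    and E: "\<And>x y. E x y \<Longrightarrow> complete_adj A B x y"
    and F: "\<And>x y. F x y \<Longrightarrow> complete_adj A B x y"
    and \<sigma>: "\<sigma> permutes A \<union> B"
  shows "\<tau> permutes A \<union> B" "fs_parity A \<tau> = fs_parity A \<sigma>"
  using assms(1) \<sigma>
proof (induction rule: fs_reach.induct)
  case (refl \<sigma>)
  case 1 then show ?case .
  case 2 show ?case ..
next
  case (step \<sigma> \<tau> x y)
  have xy: "x \<in> A \<union> B" "y \<in> A \<union> B" "x \<noteq> y"
    using E[OF step(2)] AB by (auto simp: complete_adj_def)
  case 1
  then have \<tau>: "\<tau> permutes A \<union> B" by (rule step.IH(1))
  show ?case using \<tau> xy by (intro permutes_compose permutes_swap_id)
  case 2
  have "permutation \<tau>" using \<tau> fin by (auto intro: permutes_imp_permutation[of "A \<union> B"])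
  then have sign: "sign (\<tau> \<circ> transpose x y) = - sign \<tau>"
    using xy by (simp add: sign_compose permutation_swap_id sign_swap_id)
  have flip: "(- 1 :: int) ^ card {z \<in> A. (\<tau> \<circ> transpose x y) z \<in> A} = - ((- 1) ^ card {z \<in> A. \<tau> z \<in> A})"
    if x: "x \<in> A" and y: "y \<in> B" and comp: "complete_adj A B (\<tau> x) (\<tau> y)" for x y
  proof (cases "\<tau> x \<in> A")
    case True
    then have "\<tau> y \<notin> A" using comp AB by (auto simp: complete_adj_def)
    then have "{z \<in> A. (\<tau> \<circ> transpose x y) z \<in> A} = {z \<in> A. \<tau> z \<in> A} - {x}"
      using y AB by (auto simp: transpose_def)
    moreover have "card {z \<in> A. \<tau> z \<in> A} = Suc (card ({z \<in> A. \<tau> z \<in> A} - {x}))"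
      using True x fin by (intro card.remove) auto
    ultimately show ?thesis by simp
  next
    case False
    then have "\<tau> y \<in> A" using comp AB by (auto simp: complete_adj_def)
    then have "{z \<in> A. (\<tau> \<circ> transpose x y) z \<in> A} = insert x {z \<in> A. \<tau> z \<in> A}"
      using x y AB by (auto simp: transpose_def)
    then show ?thesis using False fin by simp
  qed
  have "(- 1 :: int) ^ card {z \<in> A. (\<tau> \<circ> transpose x y) z \<in> A} = - ((- 1) ^ card {z \<in> A. \<tau> z \<in> A})"
  proof (cases "x \<in> A \<and> y \<in> B")
    case True
    then show ?thesis using flip[of x y] F[OF step(3)] by blast
  next
    case False
    then have "y \<in> A" "x \<in> B" using E[OF step(2)] by (auto simp: complete_adj_def)
    moreover have "complete_adj A B (\<tau> y) (\<tau> x)" using F[OF step(3)] by (auto simp: complete_adj_def)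
    ultimately show ?thesis using flip[of y x] by (simp only: transpose_commute)
  qed
  then show ?case
    using step.IH(2)[OF 2] unfolding fs_parity_def sign by simp
qed

text \<open>Interchanging two positions of the same side keeps the count and flips only the sign;
  this produces bijections of the other class.\<close>

lemma fs_parity_transpose:
  assumes "\<sigma> permutes A \<union> B" "finite A" "finite B" "A \<inter> B = {}"
    and "x \<noteq> y" "x \<in> A \<and> y \<in> A \<or> x \<in> B \<and> y \<in> B"
  shows "fs_parity A (\<sigma> \<circ> transpose x y) = - fs_parity A \<sigma>"
proof -
  have "permutation \<sigma>" using assms by (auto intro: permutes_imp_permutation[of "A \<union> B"])
  then have sign: "sign (\<sigma> \<circ> transpose x y) = - sign \<sigma>"
    using assms(5) by (simp add: sign_compose permutation_swap_id sign_swap_id)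
  have "transpose x y ` {z \<in> A. (\<sigma> \<circ> transpose x y) z \<in> A} = {z \<in> A. \<sigma> z \<in> A}"
  proof -
    have mem: "transpose x y z \<in> A \<longleftrightarrow> z \<in> A" for z
      using assms(4,6) by (auto simp: transpose_def)
    show ?thesis
    proof safe
      fix z assume "z \<in> A" "\<sigma> z \<in> A"
      then show "z \<in> transpose x y ` {z \<in> A. (\<sigma> \<circ> transpose x y) z \<in> A}"
        using mem[of z] by (intro image_eqI[of _ _ "transpose x y z"]) auto
    qed (auto simp: mem)
  qed
  then have "card {z \<in> A. (\<sigma> \<circ> transpose x y) z \<in> A} = card {z \<in> A. \<sigma> z \<in> A}"
    using card_image[of "transpose x y" "{z \<in> A. (\<sigma> \<circ> transpose x y) z \<in> A}"] by simp
  then show ?thesis unfolding fs_parity_def sign by simp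
qed

section \<open>Components of friends-and-strangers graphs\<close>

text \<open>With symmetric arcs, reachability is an equivalence relation on the vertices, and the
  strong components are its classes.\<close>

lemma sym_digraph_sccs_verts:
  assumes "sym_digraph G"
  shows "pre_digraph.sccs_verts G = (\<lambda>u. {v. u \<rightarrow>\<^sup>*\<^bsub>G\<^esub> v}) ` verts G"
proof -
  interpret sym_digraph G by fact
  have sym: "v \<rightarrow>\<^sup>*\<^bsub>G\<^esub> u" if "u \<rightarrow>\<^sup>*\<^bsub>G\<^esub> v" for u v
    using symmetric_reachable[OF sym_arcs that] .
  show ?thesis
  proof (intro set_eqI iffI)
    fix S assume "S \<in> sccs_verts"
    then have S: "S \<noteq> {}" "\<And>u v. u \<in> S \<Longrightarrow> v \<in> S \<Longrightarrow> u \<rightarrow>\<^sup>*\<^bsub>G\<^esub> v"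
      "\<And>u v. u \<in> S \<Longrightarrow> v \<notin> S \<Longrightarrow> \<not> u \<rightarrow>\<^sup>*\<^bsub>G\<^esub> v \<or> \<not> v \<rightarrow>\<^sup>*\<^bsub>G\<^esub> u"
      unfolding in_sccs_verts_conv_reachable by blast+
    then obtain u where u: "u \<in> S" by blast
    have "S = {v. u \<rightarrow>\<^sup>*\<^bsub>G\<^esub> v}" using S(2,3) u sym by blast
    moreover have "u \<in> verts G" using reachable_in_verts(1)[OF S(2)[OF u u]] .
    ultimately show "S \<in> (\<lambda>u. {v. u \<rightarrow>\<^sup>*\<^bsub>G\<^esub> v}) ` verts G" by blast
  next
    fix S assume "S \<in> (\<lambda>u. {v. u \<rightarrow>\<^sup>*\<^bsub>G\<^esub> v}) ` verts G"
    then obtain u where u: "u \<in> verts G" "S = {v. u \<rightarrow>\<^sup>*\<^bsub>G\<^esub> v}" by blast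
    then show "S \<in> sccs_verts"
      unfolding in_sccs_verts_conv_reachable using sym reachable_trans reachable_refl by blast
  qed
qed

lemma num_components_eq_card_classes:
  assumes "pair_graph G"
  shows "num_components G = card ((\<lambda>u. {v. u \<rightarrow>\<^sup>*\<^bsub>with_proj G\<^esub> v}) ` pverts G)"
proof -
  interpret pair_graph G by fact
  have "sym_digraph (with_proj G)" by unfold_locales
  then show ?thesis
    using sym_digraph_sccs_verts card_sccs_verts unfolding num_components_def by fastforce
qed

lemma num_components_eq_2:
  assumes G: "pair_graph G" and uv: "u \<in> pverts G" "v \<in> pverts G" "\<not> u \<rightarrow>\<^sup>*\<^bsub>with_proj G\<^esub> v"
    and cover: "\<And>w. w \<in> pverts G \<Longrightarrow> w \<rightarrow>\<^sup>*\<^bsub>with_proj G\<^esub> u \<or> w \<rightarrow>\<^sup>*\<^bsub>with_proj G\<^esub> v"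
  shows "num_components G = 2"
proof -
  interpret pair_graph G by fact
  have sym: "y \<rightarrow>\<^sup>*\<^bsub>with_proj G\<^esub> x" if "x \<rightarrow>\<^sup>*\<^bsub>with_proj G\<^esub> y" for x y
    using symmetric_reachable[OF sym_arcs that] .
  let ?cl = "\<lambda>u. {v. u \<rightarrow>\<^sup>*\<^bsub>with_proj G\<^esub> v}"
  have eq: "?cl x = ?cl y" if "x \<rightarrow>\<^sup>*\<^bsub>with_proj G\<^esub> y" for x y
    using that sym reachable_trans by blast
  have "?cl ` pverts G = {?cl u, ?cl v}"
  proof (intro equalityI subsetI)
    fix S assume "S \<in> ?cl ` pverts G"
    then obtain w where w: "w \<in> pverts G" "S = ?cl w" by blast
    from cover[OF w(1)] show "S \<in> {?cl u, ?cl v}"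
    proof
      assume "w \<rightarrow>\<^sup>*\<^bsub>with_proj G\<^esub> u"
      from eq[OF this] w(2) show ?thesis by simp
    next
      assume "w \<rightarrow>\<^sup>*\<^bsub>with_proj G\<^esub> v"
      from eq[OF this] w(2) show ?thesis by simp
    qed
  next
    fix S assume "S \<in> {?cl u, ?cl v}"
    with uv(1,2) show "S \<in> ?cl ` pverts G" by auto
  qed
  moreover have "?cl u \<noteq> ?cl v" using uv reachable_refl by auto
  ultimately show ?thesis
    using num_components_eq_card_classes[OF G] by simp
qed

lemma num_components_ge_3:
  assumes G: "pair_graph G" and V: "u \<in> pverts G" "v \<in> pverts G" "w \<in> pverts G"
    and nr: "\<not> u \<rightarrow>\<^sup>*\<^bsub>with_proj G\<^esub> v" "\<not> u \<rightarrow>\<^sup>*\<^bsub>with_proj G\<^esub> w" "\<not> v \<rightarrow>\<^sup>*\<^bsub>with_proj G\<^esub> w"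
  shows "num_components G \<ge> 3"
proof -
  interpret pair_graph G by fact
  let ?cl = "\<lambda>u. {v. u \<rightarrow>\<^sup>*\<^bsub>with_proj G\<^esub> v}"
  have "?cl u \<noteq> ?cl v" "?cl u \<noteq> ?cl w" "?cl v \<noteq> ?cl w" using V nr reachable_refl by auto
  then have "card {?cl u, ?cl v, ?cl w} = 3" by simp
  moreover have "card {?cl u, ?cl v, ?cl w} \<le> card (?cl ` pverts G)"
    using V pair_finite_verts by (intro card_mono) auto
  ultimately show ?thesis using num_components_eq_card_classes[OF G] by simp
qed

section \<open>Swap sequences and reachability in the friends-and-strangers graph\<close>

abbreviation padj :: "'a pair_pre_digraph \<Rightarrow> 'a \<Rightarrow> 'a \<Rightarrow> bool" where
  "padj G x y \<equiv> (x, y) \<in> parcs G"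

lemma restrict_permutes_graph_bijections:
  assumes "\<sigma> permutes pverts X" "pverts Y = pverts X"
  shows "restrict \<sigma> (pverts X) \<in> graph_bijections X Y"
  using permutes_imp_bij[OF assms(1)] assms(2)
  by (simp add: graph_bijections_def)

lemma reachable_of_fs_reach:
  assumes XY: "pair_graph X" "pair_graph Y" "pverts Y = pverts X"
    and reach: "fs_reach (padj X) (padj Y) \<sigma> \<tau>" and \<sigma>: "\<sigma> permutes pverts X"
  shows "restrict \<sigma> (pverts X) \<rightarrow>\<^sup>*\<^bsub>with_proj (friends_strangers X Y)\<^esub> restrict \<tau> (pverts X)"
    and "\<tau> permutes pverts X"
  using reach \<sigma>
proof (induction rule: fs_reach.induct)
  interpret FS: pair_graph "friends_strangers X Y"
    using XY(1,2) by (rule pair_graph_friends_strangers)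
  interpret X: pair_graph X by fact
  {
    case (refl \<sigma>)
    case 1
    have "restrict \<sigma> (pverts X) \<in> pverts (friends_strangers X Y)"
      using restrict_permutes_graph_bijections[OF 1 XY(3)] by (simp add: friends_strangers_def)
    then show ?case by (rule FS.reachable_refl)
    case 2 then show ?case .
  next
    case (step \<sigma> \<tau> a b)
    have ab: "a \<in> pverts X" "b \<in> pverts X"
      using X.arc_fst_in_verts[OF step(2)] X.arc_snd_in_verts[OF step(2)] by auto
    have perm: "\<tau> \<circ> transpose a b permutes pverts X" if "\<sigma> permutes pverts X"
      using step.IH(2)[OF that] ab by (intro permutes_compose permutes_swap_id)
    case 1
    have "padj X a b \<and> (restrict \<tau> (pverts X) a, restrict \<tau> (pverts X) b) \<in> parcs Y \<and>
        restrict \<tau> (pverts X) a = restrict (\<tau> \<circ> transpose a b) (pverts X) b \<and>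
        restrict \<tau> (pverts X) b = restrict (\<tau> \<circ> transpose a b) (pverts X) a \<and>
        (\<forall>c \<in> pverts X - {a, b}. restrict \<tau> (pverts X) c = restrict (\<tau> \<circ> transpose a b) (pverts X) c)"
      using step(2,3) ab by auto
    then have "(restrict \<tau> (pverts X), restrict (\<tau> \<circ> transpose a b) (pverts X)) \<in> parcs (friends_strangers X Y)"
      unfolding friends_strangers_def pair_pre_digraph.simps mem_Collect_eq prod.case
      using restrict_permutes_graph_bijections[OF step.IH(2)[OF 1] XY(3)]
        restrict_permutes_graph_bijections[OF perm[OF 1] XY(3)] by blast
    with step.IH(1)[OF 1] show ?case by (rule FS.reachable_adj_trans)
    case 2 then show ?case by (rule perm)
  }
qed

text \<open>Undoes restriction to \<open>V\<close> for permutations of \<open>V\<close>: the value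
  \<open>undefined\<close> outside gives way to the identity, so that composition and sign make
  sense.\<close>

definition extend_id :: "'a set \<Rightarrow> ('a \<Rightarrow> 'a) \<Rightarrow> 'a \<Rightarrow> 'a" where
  "extend_id V \<sigma> x = (if x \<in> V then \<sigma> x else x)"

lemma extend_id_restrict: "\<sigma> permutes V \<Longrightarrow> extend_id V (restrict \<sigma> V) = \<sigma>"
  by (auto simp: extend_id_def fun_eq_iff permutes_not_in)

lemma graph_bijections_extend_id:
  assumes "\<sigma> \<in> graph_bijections X Y" "pverts Y = pverts X"
  shows "extend_id (pverts X) \<sigma> permutes pverts X" "restrict (extend_id (pverts X) \<sigma>) (pverts X) = \<sigma>"
proof -
  have "bij_betw \<sigma> (pverts X) (pverts X)" "\<sigma> \<in> extensional (pverts X)"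
    using assms by (auto simp: graph_bijections_def)
  then show "restrict (extend_id (pverts X) \<sigma>) (pverts X) = \<sigma>"
    by (auto simp: fun_eq_iff extend_id_def extensional_def)
  have "bij_betw (extend_id (pverts X) \<sigma>) (pverts X) (pverts X)"
    using \<open>bij_betw \<sigma> _ _\<close> by (subst bij_betw_cong[of _ _ \<sigma>]) (auto simp: extend_id_def)
  then show "extend_id (pverts X) \<sigma> permutes pverts X"
    by (rule bij_imp_permutes) (simp add: extend_id_def)
qed

lemma fs_reach_of_reachable:
  assumes XY: "pair_graph X" "pair_graph Y" "pverts Y = pverts X"
    and reach: "\<sigma> \<rightarrow>\<^sup>*\<^bsub>with_proj (friends_strangers X Y)\<^esub> \<tau>"
  shows "fs_reach (padj X) (padj Y) (extend_id (pverts X) \<sigma>) (extend_id (pverts X) \<tau>)"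
proof -
  interpret FS: pair_graph "friends_strangers X Y"
    using XY(1,2) by (rule pair_graph_friends_strangers)
  interpret X: pair_graph X by fact
  show ?thesis
    using reach
  proof (induction rule: FS.reachable_induct)
    case base
    show ?case by (rule fs_reach.refl)
  next
    case (step \<tau> \<upsilon>)
    then have "(\<tau>, \<upsilon>) \<in> parcs (friends_strangers X Y)" by simp
    then obtain a b where ab: "padj X a b" "padj Y (\<tau> a) (\<tau> b)" "\<tau> a = \<upsilon> b" "\<tau> b = \<upsilon> a"
      "\<forall>c \<in> pverts X - {a, b}. \<tau> c = \<upsilon> c"
      unfolding friends_strangers_def by auto
    have V: "a \<in> pverts X" "b \<in> pverts X"
      using X.arc_fst_in_verts[OF ab(1)] X.arc_snd_in_verts[OF ab(1)] by auto
    have eq: "extend_id (pverts X) \<upsilon> = extend_id (pverts X) \<tau> \<circ> transpose a b"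
      using ab V by (auto simp: fun_eq_iff extend_id_def transpose_def)
    have "padj Y (extend_id (pverts X) \<tau> a) (extend_id (pverts X) \<tau> b)"
      using ab(2) V by (simp add: extend_id_def)
    then show ?case
      unfolding eq using fs_reach.step[where E="padj X" and F="padj Y", OF step.IH ab(1)] by blast
  qed
qed

section \<open>Minimum degree and the upper bound\<close>

lemma out_degree_pair:
  "out_degree (with_proj G) v = card {y. padj G v y}"
proof -
  have "out_arcs (with_proj G) v = Pair v ` {y. padj G v y}"
    by (auto simp: out_arcs_def)
  then show ?thesis unfolding out_degree_def by (simp add: card_image inj_on_def)
qed

lemma edge_subgraph_nearly_complete:
  assumes X: "edge_subgraph X K" and d: "min_degree X \<ge> d"
    and K: "pverts K = A \<union> B" "parcs K = A \<times> B \<union> B \<times> A"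
    and AB: "finite A" "finite B" "A \<inter> B = {}" "card A = r" "card B = r"
  shows "pair_graph X" "pverts X = A \<union> B" "nearly_complete A B (r - d) (padj X)"
    and "padj X x y \<Longrightarrow> complete_adj A B x y"
proof -
  show X': "pair_graph X" and V: "pverts X = A \<union> B"
    using X K unfolding edge_subgraph_def spanning_def by auto
  have sub: "parcs X \<subseteq> A \<times> B \<union> B \<times> A"
    using X K unfolding edge_subgraph_def spanning_def subgraph_def by auto
  then show "complete_adj A B x y" if "padj X x y" for x y
    using that unfolding complete_adj_def by blast
  interpret pair_graph X by fact
  have deg: "d \<le> card {y. padj X v y}" if "v \<in> A \<union> B" for v
  proof -
    have "min_degree X \<le> out_degree (with_proj X) v"
      unfolding min_degree_def using V that AB by (intro Min_le) auto
    with d show ?thesis by (simp add: out_degree_pair)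
  qed
  have miss: "card {y \<in> T. \<not> padj X v y} \<le> r - d"
    if "v \<in> A \<union> B" "{y. padj X v y} \<subseteq> T" "finite T" "card T = r" for v T
  proof -
    have "{y \<in> T. \<not> padj X v y} = T - {y. padj X v y}" by blast
    then have "card {y \<in> T. \<not> padj X v y} = r - card {y. padj X v y}"
      using card_Diff_subset[OF finite_subset[OF that(2,3)] that(2)] that(4) by (simp only:)
    with deg[OF that(1)] show ?thesis by simp
  qed
  have "symp (padj X)" using pair_sym_arcs by (auto simp: symp_def symmetric_def dest: symD)
  moreover have "card {y \<in> B. \<not> padj X x y} \<le> r - d" if "x \<in> A" for x
    using miss[of x B] that sub AB by blast
  moreover have "card {x \<in> A. \<not> padj X y x} \<le> r - d" if "y \<in> B" for y
    using miss[of y A] that sub AB by blast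
  ultimately show "nearly_complete A B (r - d) (padj X)"
    using AB unfolding nearly_complete_def by blast
qed

text \<open>The normal form carries over from the complete graphs, so every vertex reaches the
  identity or one fixed transposition. These two have opposite parity and cannot reach each
  other.\<close>

lemma num_components_dense:
  assumes X: "edge_subgraph X K" "min_degree X \<ge> d" and Y: "edge_subgraph Y K" "min_degree Y \<ge> d"
    and K: "complete_bipartite_digraph r r (with_proj K)" and r: "2 \<le> r" "4 * (r - d) + 1 \<le> r"
  shows "num_components (friends_strangers X Y) = 2"
proof -
  obtain A B where AB: "pverts K = A \<union> B" "parcs K = A \<times> B \<union> B \<times> A" "A \<inter> B = {}" "card A = r" "card B = r"
    and fin: "finite (pverts K)"
    using K unfolding complete_bipartite_digraph_pair_def by blast
  then have finA: "finite A" "finite B" by auto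
  note nc = edge_subgraph_nearly_complete[OF _ _ AB(1,2) finA AB(3-5)]
  note ncX = nc[OF X] and ncY = nc[OF Y]
  have YX: "pverts Y = pverts X" using ncX(2) ncY(2) by simp
  obtain a a' where a: "a \<in> A" "a' \<in> A" "a \<noteq> a'"
    using AB(4) r(1) by (metis card_2_iff' obtain_subset_with_card_n subsetD)
  obtain b b' where b: "b \<in> B" "b' \<in> B" "b \<noteq> b'"
    using AB(5) r(1) by (metis card_2_iff' obtain_subset_with_card_n subsetD)
  let ?FS = "friends_strangers X Y"
  let ?V = "pverts X"
  have V: "?V = A \<union> B" by (rule ncX(2))
  have perm: "id permutes ?V" "transpose b b' permutes ?V"
    using b V by (auto intro: permutes_id permutes_swap_id)
  have verts: "restrict \<sigma> ?V \<in> pverts ?FS" if "\<sigma> permutes ?V" for \<sigma>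
    using restrict_permutes_graph_bijections[OF that YX] by (simp add: friends_strangers_def)
  show ?thesis
  proof (rule num_components_eq_2)
    show "pair_graph ?FS" using ncX(1) ncY(1) by (rule pair_graph_friends_strangers)
    show "restrict id ?V \<in> pverts ?FS" "restrict (transpose b b') ?V \<in> pverts ?FS"
      using verts perm by blast+
    show "\<not> restrict id ?V \<rightarrow>\<^sup>*\<^bsub>with_proj ?FS\<^esub> restrict (transpose b b') ?V"
    proof
      assume "restrict id ?V \<rightarrow>\<^sup>*\<^bsub>with_proj ?FS\<^esub> restrict (transpose b b') ?V"
      from fs_reach_of_reachable[OF ncX(1) ncY(1) YX this]
      have "fs_reach (padj X) (padj Y) id (transpose b b')"
        unfolding extend_id_restrict[OF perm(1)] extend_id_restrict[OF perm(2)] .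
      from fs_parity_reach(2)[OF this finA AB(3) ncX(4) ncY(4)]
      have "fs_parity A (transpose b b') = fs_parity A id" using perm(1) V by simp
      moreover have "fs_parity A (id \<circ> transpose b b') = - fs_parity A id"
        using perm(1) V finA AB(3) b by (intro fs_parity_transpose[where B=B]) auto
      moreover have "fs_parity A id \<noteq> 0" by (simp add: fs_parity_def)
      ultimately show False by simp
    qed
    fix \<sigma> assume "\<sigma> \<in> pverts ?FS"
    then have "\<sigma> \<in> graph_bijections X Y" by (simp add: friends_strangers_def)
    note ext = graph_bijections_extend_id[OF this YX]
    let ?\<sigma> = "extend_id ?V \<sigma>"
    have "fs_reach (padj X) (padj Y) ?\<sigma> \<tau>" if "fs_reach (complete_adj A B) (complete_adj A B) ?\<sigma> \<tau>" for \<tau>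
      using fs_reach_of_complete[OF ncX(3,4) ncY(3,4) AB(4,5) r(2) _ that] ext(1) V by simp
    then have "fs_reach (padj X) (padj Y) ?\<sigma> id \<or> fs_reach (padj X) (padj Y) ?\<sigma> (transpose b b')"
      using fs_reach_complete_normal_form[OF finA AB(3) _ a b] ext(1) V AB(4,5) by metis
    then show "\<sigma> \<rightarrow>\<^sup>*\<^bsub>with_proj ?FS\<^esub> restrict id ?V \<or> \<sigma> \<rightarrow>\<^sup>*\<^bsub>with_proj ?FS\<^esub> restrict (transpose b b') ?V"
      using reachable_of_fs_reach(1)[OF ncX(1) ncY(1) YX _ ext(1)] ext(2) by metis
  qed
qed

section \<open>Extremal graphs\<close>

text \<open>
  The two graphs split the edges inside each half between them, so that \<open>half_swap\<close> maps every edge of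
  one to a non-edge of the other and is an isolated vertex.  Halving the halves once more leaves
  each vertex with about a quarter of its possible neighbours missing.
\<close>

definition half_adj :: "nat \<Rightarrow> bool \<Rightarrow> nat \<Rightarrow> nat \<Rightarrow> bool" where
  "half_adj r p i j \<longleftrightarrow> (i < r div 2) \<noteq> (j < r div 2) \<or> even (i + j) = p"

definition half_graph :: "nat \<Rightarrow> bool \<Rightarrow> nat pair_pre_digraph" where
  "half_graph r p = \<lparr>pverts = {..<2 * r},
    parcs = {(x, y). x < r \<and> r \<le> y \<and> y < 2 * r \<and> half_adj r p x (y - r) \<or>
      y < r \<and> r \<le> x \<and> x < 2 * r \<and> half_adj r p y (x - r)}\<rparr>"

definition half_swap :: "nat \<Rightarrow> nat \<Rightarrow> nat" where
  "half_swap r x = (if r div 2 \<le> x \<and> x < r then x + r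
    else if r + r div 2 \<le> x \<and> x < 2 * r then x - r else x)"

text \<open>Cut the interval into consecutive pairs, the last possibly incomplete: each contains at
  most one number of a given parity.\<close>

lemma card_parity_le: "card {j \<in> {l..<l + n}. even j = p} \<le> (n + 1) div 2" for l n :: nat
proof -
  have "card {j \<in> {l..<l + n}. even j = p} \<le> card {..<(n + 1) div 2}"
  proof (rule card_inj_on_le)
    show "inj_on (\<lambda>j. (j - l) div 2) {j \<in> {l..<l + n}. even j = p}"
    proof (rule inj_onI)
      fix i j assume "i \<in> {j \<in> {l..<l + n}. even j = p}" "j \<in> {j \<in> {l..<l + n}. even j = p}"
        "(i - l) div 2 = (j - l) div 2"
      then have "l \<le> i" "l \<le> j" "even i = even j" "(i - l) div 2 = (j - l) div 2" by auto
      moreover have "i' = j'" if "even (l + i') = even (l + j')" "i' div 2 = j' div 2" for i' j' :: nat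
        using that by presburger
      from this[of "i - l" "j - l"] calculation show "i = j" by simp
    qed
    show "(\<lambda>j. (j - l) div 2) ` {j \<in> {l..<l + n}. even j = p} \<subseteq> {..<(n + 1) div 2}"
      by auto
  qed auto
  then show ?thesis by simp
qed

lemma half_adj_commute: "half_adj r p i j = half_adj r p j i"
  by (auto simp: half_adj_def add.commute)

text \<open>The non-neighbours of \<open>i\<close> lie in its own half and share one parity. The
  larger half has \<open>r - r div 2\<close> elements, so there are at most r/4 of them, rounded
  up.\<close>

lemma card_half_adj_ge:
  assumes "i < r"
  shows "3 * r div 4 \<le> card {j. j < r \<and> half_adj r p i j}"
proof -
  define l where "l = (if i < r div 2 then 0 else r div 2)"
  define n where "n = (if i < r div 2 then r div 2 else r - r div 2)"
  let ?M = "{j \<in> {l..<l + n}. even j = (even i \<noteq> p)}"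
  have "{..<r} \<subseteq> {j. j < r \<and> half_adj r p i j} \<union> ?M"
    by (auto simp: half_adj_def l_def n_def)
  then have "card {..<r} \<le> card ({j. j < r \<and> half_adj r p i j} \<union> ?M)"
    by (intro card_mono) auto
  also have "\<dots> \<le> card {j. j < r \<and> half_adj r p i j} + card ?M" by (rule card_Un_le)
  also have "card ?M \<le> (n + 1) div 2" by (rule card_parity_le)
  finally have "r \<le> card {j. j < r \<and> half_adj r p i j} + (n + 1) div 2" by simp
  moreover have "(n + 1) div 2 + 3 * r div 4 \<le> r" unfolding n_def by (auto split: if_splits)
  ultimately show ?thesis by linarith
qed

definition nat_complete_bipartite :: "nat \<Rightarrow> nat pair_pre_digraph" where
  "nat_complete_bipartite r = \<lparr>pverts = {..<2 * r},
    parcs = {..<r} \<times> {r..<2 * r} \<union> {r..<2 * r} \<times> {..<r}\<rparr>"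

lemma complete_bipartite_nat: "complete_bipartite_digraph r r (with_proj (nat_complete_bipartite r))"
  unfolding complete_bipartite_digraph_pair_def nat_complete_bipartite_def
  by (rule conjI, simp, rule exI[of _ "{..<r}"], rule exI[of _ "{r..<2 * r}"]) auto

lemma pair_graph_half_graph: "pair_graph (half_graph r p)"
proof -
  have "finite (parcs (half_graph r p))"
    by (rule finite_subset[of _ "{..<2 * r} \<times> {..<2 * r}"]) (auto simp: half_graph_def)
  moreover have "sym (parcs (half_graph r p))"
    by (rule symI) (auto simp: half_graph_def)
  ultimately show ?thesis
    by unfold_locales (auto simp: half_graph_def symmetric_def)
qed

lemma edge_subgraph_half_graph: "edge_subgraph (half_graph r p) (nat_complete_bipartite r)"
proof -
  interpret H: pair_graph "half_graph r p" by (rule pair_graph_half_graph)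
  interpret K: pair_graph "nat_complete_bipartite r"
    by (rule pair_graphI_complete_bipartite[OF complete_bipartite_nat])
  have "parcs (half_graph r p) \<subseteq> parcs (nat_complete_bipartite r)"
    by (auto simp: half_graph_def nat_complete_bipartite_def)
  then have "subgraph (with_proj (half_graph r p)) (with_proj (nat_complete_bipartite r))"
    unfolding subgraph_def using H.wf_digraph_axioms K.wf_digraph_axioms
    by (auto simp: half_graph_def nat_complete_bipartite_def compatible_def)
  then show ?thesis
    unfolding edge_subgraph_def spanning_def using pair_graph_half_graph
    by (simp add: half_graph_def nat_complete_bipartite_def)
qed

lemma min_degree_half_graph:
  assumes "r \<ge> 1"
  shows "3 * r div 4 \<le> min_degree (half_graph r p)"
proof -
  have "3 * r div 4 \<le> card {y. padj (half_graph r p) v y}" if "v < 2 * r" for v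
  proof (cases "v < r")
    case True
    have "(\<lambda>j. j + r) ` {j. j < r \<and> half_adj r p v j} \<subseteq> {y. padj (half_graph r p) v y}"
      using True by (auto simp: half_graph_def)
    then have "card ((\<lambda>j. j + r) ` {j. j < r \<and> half_adj r p v j}) \<le> card {y. padj (half_graph r p) v y}"
      by (rule card_mono[rotated]) (rule finite_subset[of _ "{..<2 * r}"]; auto simp: half_graph_def)
    then show ?thesis using card_half_adj_ge[OF True, of p] by (simp add: card_image)
  next
    case False
    then have v: "v - r < r" using that by simp
    have "{j. j < r \<and> half_adj r p (v - r) j} \<subseteq> {y. padj (half_graph r p) v y}"
      using False that by (auto simp: half_graph_def half_adj_commute)
    then have "card {j. j < r \<and> half_adj r p (v - r) j} \<le> card {y. padj (half_graph r p) v y}"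
      by (rule card_mono[rotated]) (rule finite_subset[of _ "{..<2 * r}"]; auto simp: half_graph_def)
    then show ?thesis using card_half_adj_ge[OF v, of p] by simp
  qed
  moreover have "pverts (half_graph r p) = {..<2 * r}" by (simp add: half_graph_def)
  moreover have "0 \<in> {..<2 * r}" using assms by simp
  then have "{..<2 * r} \<noteq> {}" by blast
  ultimately show ?thesis
    unfolding min_degree_def out_degree_pair by (subst Min_ge_iff) auto
qed

lemma half_swap_permutes: "half_swap r permutes {..<2 * r}"
proof (rule bij_imp_permutes)
  have inv: "half_swap r (half_swap r x) = x" for x
    by (auto simp: half_swap_def)
  show "bij_betw (half_swap r) {..<2 * r} {..<2 * r}"
    by (rule bij_betwI[where g="half_swap r"]) (use inv in \<open>auto simp: half_swap_def\<close>)
qed (auto simp: half_swap_def)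

text \<open>Adjacent positions from different halves are sent to the same side, where there are no
  edges. For positions from the same half the images still lie across, but the parity demanded by
  the other graph is the opposite one.\<close>

lemma half_swap_isolated:
  assumes "padj (half_graph r True) x y"
  shows "\<not> padj (half_graph r False) (half_swap r x) (half_swap r y)"
proof -
  have *: "\<not> padj (half_graph r False) (half_swap r i) (half_swap r (r + j))"
    "\<not> padj (half_graph r False) (half_swap r (r + j)) (half_swap r i)"
    if "i < r" "j < r" "half_adj r True i j" for i j
    using that by (auto simp: half_graph_def half_swap_def half_adj_def add.commute)
  from assms consider "x < r" "r \<le> y" "y - r < r" "half_adj r True x (y - r)"
    | "y < r" "r \<le> x" "x - r < r" "half_adj r True y (x - r)"
    by (auto simp: half_graph_def)
  then show ?thesis
    using *[of x "y - r"] *[of y "x - r"] by cases auto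
qed

text \<open>\<open>half_swap r\<close> is a component by itself. Of the two further bijections, one
  has the same parity as it and the other the opposite, so they are separated from each other as
  well.\<close>

lemma num_components_half_graphs:
  assumes r: "r \<ge> 2"
  shows "num_components (friends_strangers (half_graph r True) (half_graph r False)) \<ge> 3"
proof -
  let ?X = "half_graph r True" and ?Y = "half_graph r False"
  let ?FS = "friends_strangers ?X ?Y"
  let ?A = "{..<r}" and ?B = "{r..<2 * r}"
  have V: "pverts ?X = ?A \<union> ?B" "pverts ?Y = pverts ?X" using r by (auto simp: half_graph_def)
  have adj: "complete_adj ?A ?B x y" if "padj (half_graph r p) x y" for p x y
    using that by (auto simp: half_graph_def complete_adj_def)
  define \<sigma> where "\<sigma> = half_swap r"
  define \<tau> where "\<tau> = \<sigma> \<circ> transpose 0 1"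
  define \<upsilon> where "\<upsilon> = \<tau> \<circ> transpose r (r + 1)"
  have perm: "\<sigma> permutes ?A \<union> ?B" "\<tau> permutes ?A \<union> ?B" "\<upsilon> permutes ?A \<union> ?B"
  proof -
    show "\<sigma> permutes ?A \<union> ?B" using half_swap_permutes[of r] V by (simp add: \<sigma>_def half_graph_def)
    then show "\<tau> permutes ?A \<union> ?B"
      unfolding \<tau>_def using r by (intro permutes_compose permutes_swap_id) auto
    then show "\<upsilon> permutes ?A \<union> ?B"
      unfolding \<upsilon>_def using r by (intro permutes_compose permutes_swap_id) auto
  qed
  have parity: "fs_parity ?A \<tau> = - fs_parity ?A \<sigma>" "fs_parity ?A \<upsilon> = - fs_parity ?A \<tau>"
    unfolding \<tau>_def \<upsilon>_def using r perm
    by (intro fs_parity_transpose[where B="?B"]; auto simp: \<tau>_def)+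
  have nz: "fs_parity ?A \<rho> \<noteq> 0" for \<rho> by (simp add: fs_parity_def)
  have isolated': "\<rho> = \<sigma>'" if "fs_reach (padj ?X) (padj ?Y) \<sigma>' \<rho>" "\<sigma>' = half_swap r" for \<sigma>' \<rho>
    using that
  proof (induction rule: fs_reach.induct)
    case (step \<sigma>' \<rho> a b)
    then show ?case using half_swap_isolated[OF step(2)] by simp
  qed simp
  have isolated: "\<rho> = \<sigma>" if "fs_reach (padj ?X) (padj ?Y) \<sigma> \<rho>" for \<rho>
    using isolated'[OF that] by (simp add: \<sigma>_def)
  have "\<tau> \<noteq> \<sigma>" using parity(1) nz[of \<sigma>] by force
  \<comment> \<open>Parity cannot separate these two, so they are compared at position
    \<open>0\<close>, where \<open>\<upsilon>\<close> takes the value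
    \<open>\<sigma> 1\<close>.\<close>
  have "\<upsilon> \<noteq> \<sigma>"
  proof
    assume "\<upsilon> = \<sigma>"
    then have "\<sigma> 1 = \<sigma> 0" using r by (auto simp: \<upsilon>_def \<tau>_def dest!: fun_cong[of _ _ 0])
    then show False using permutes_inj[OF perm(1)] by (auto dest: injD)
  qed
  have reach: "fs_reach (padj ?X) (padj ?Y) \<rho> \<rho>'"
    if "restrict \<rho> (pverts ?X) \<rightarrow>\<^sup>*\<^bsub>with_proj ?FS\<^esub> restrict \<rho>' (pverts ?X)"
      "\<rho> permutes ?A \<union> ?B" "\<rho>' permutes ?A \<union> ?B" for \<rho> \<rho>'
    using fs_reach_of_reachable[OF pair_graph_half_graph pair_graph_half_graph V(2) that(1)]
      extend_id_restrict[OF that(2)] extend_id_restrict[OF that(3)] V(1) by simp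
  have verts: "restrict \<rho> (pverts ?X) \<in> pverts ?FS" if "\<rho> permutes ?A \<union> ?B" for \<rho>
    using restrict_permutes_graph_bijections[of \<rho> ?X ?Y] that V by (simp add: friends_strangers_def)
  show ?thesis
  proof (rule num_components_ge_3)
    show "pair_graph ?FS"
      using pair_graph_half_graph pair_graph_half_graph by (rule pair_graph_friends_strangers)
    show "restrict \<sigma> (pverts ?X) \<in> pverts ?FS" "restrict \<tau> (pverts ?X) \<in> pverts ?FS"
      "restrict \<upsilon> (pverts ?X) \<in> pverts ?FS"
      using verts perm by blast+
    show "\<not> restrict \<sigma> (pverts ?X) \<rightarrow>\<^sup>*\<^bsub>with_proj ?FS\<^esub> restrict \<tau> (pverts ?X)"
      using isolated[OF reach[OF _ perm(1,2)]] \<open>\<tau> \<noteq> \<sigma>\<close> by blast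
    show "\<not> restrict \<sigma> (pverts ?X) \<rightarrow>\<^sup>*\<^bsub>with_proj ?FS\<^esub> restrict \<upsilon> (pverts ?X)"
      using isolated[OF reach[OF _ perm(1,3)]] \<open>\<upsilon> \<noteq> \<sigma>\<close> by blast
    show "\<not> restrict \<tau> (pverts ?X) \<rightarrow>\<^sup>*\<^bsub>with_proj ?FS\<^esub> restrict \<upsilon> (pverts ?X)"
    proof
      assume "restrict \<tau> (pverts ?X) \<rightarrow>\<^sup>*\<^bsub>with_proj ?FS\<^esub> restrict \<upsilon> (pverts ?X)"
      from reach[OF this perm(2,3)] have "fs_parity ?A \<upsilon> = fs_parity ?A \<tau>"
        by (rule fs_parity_reach(2)[where B="?B"])
          (use adj[where p=True] adj[where p=False] perm(2) in auto)
      with parity(2) nz[of \<tau>] show False by simp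
    qed
  qed
qed

section \<open>The exact threshold\<close>

theorem corollary1p3:
  fixes r :: nat
  assumes "r \<ge> 2"
  shows "int (d_bipartite r) = \<lceil>(3 * real r + 1) / 4\<rceil>"
proof -
  \<comment> \<open>This is (3r+1)/4 rounded up, and equally \<open>3 * r div 4 + 1\<close>. The
    first form gives \<open>4 * (r - d) + 1 \<le> r\<close>; by the second, every
    \<open>e < d\<close> is at most the degree bound of the extremal graphs.\<close>
  define d where "d = (3 * r + 4) div 4"
  have "d_bipartite r = d"
    unfolding d_bipartite_def
  proof (rule Least_equality, intro allI impI)
    fix K X Y :: "nat pair_pre_digraph"
    assume "complete_bipartite_digraph r r (with_proj K)" "edge_subgraph X K" "edge_subgraph Y K"
      "d \<le> min_degree X" "d \<le> min_degree Y"
    then show "num_components (friends_strangers X Y) = 2"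
      using assms by (intro num_components_dense[of X K d Y r]) (auto simp: d_def)
  next
    fix e
    assume e: "\<forall>K X Y :: nat pair_pre_digraph. complete_bipartite_digraph r r (with_proj K) \<longrightarrow>
      edge_subgraph X K \<longrightarrow> edge_subgraph Y K \<longrightarrow> e \<le> min_degree X \<longrightarrow> e \<le> min_degree Y \<longrightarrow>
      num_components (friends_strangers X Y) = 2"
    show "d \<le> e"
    proof (rule ccontr)
      assume "\<not> d \<le> e"
      then have "e \<le> 3 * r div 4" unfolding d_def by linarith
      then have "e \<le> min_degree (half_graph r p)" for p
        using min_degree_half_graph[of r p] assms by linarith
      then have "num_components (friends_strangers (half_graph r True) (half_graph r False)) = 2"
        using e complete_bipartite_nat edge_subgraph_half_graph by blast
      with num_components_half_graphs[OF assms] show False by simp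
    qed
  qed
  moreover have "\<lceil>(3 * real r + 1) / 4\<rceil> = int d"
  proof (rule ceiling_unique)
    have "3 * r + 1 \<le> 4 * d" "4 * d \<le> 3 * r + 4" unfolding d_def by linarith+
    then have "real (3 * r + 1) \<le> real (4 * d)" "real (4 * d) \<le> real (3 * r + 4)"
      by (simp_all only: of_nat_le_iff)
    then show "real_of_int (int d) - 1 < (3 * real r + 1) / 4" "(3 * real r + 1) / 4 \<le> real_of_int (int d)"
      by simp_all
  qed
  ultimately show ?thesis by simp
qed

end
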